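(* Consider the algorithm ODAAF (defined in the context) run without its bridge period (step (3) omitted), with phase lengths $n_m$ given by choice (N1). Suppose Assumption 1 holds. Then the expected pseudo-regret satisfies $$\mathbb{E}[\mathrm{Reg}_T]\le \sum_{j:\,\Delta_j>0}\Big(\frac{128\log(T\Delta_j^2)}{\Delta_j}+\frac{32}{3}\log(T\Delta_j^2)+96\log(4/\Delta_j)\,\mathbb{E}[\tau]+\frac{480}{\Delta_j}+\Delta_j\Big),$$ i.e. $\mathbb{E}[\mathrm{Reg}_T]\le \sum_{j:\Delta_j>0}O\big(\log(T\Delta_j^2)/\Delta_j+\log(1/\Delta_j)\mathbb{E}[\tau]\big)$.
   Context: Setting (stochastic bandit with delayed, aggregated anonymous feedback): there are $K\ge 2$ arms $\mathcal{A}=\{1,\dots,K\}$. Arm $j$ has a reward distribution $\zeta_j$ supported in $[0,1]$ with mean $\mu_j$; $\mu^*=\max_j\mu_j$, $\Delta_j=\mu^*-\mu_j$, and $j^*$ denotes a fixed optimal arm. There is a single delay distribution on $\{0,1,2,\dots\}$ common to all arms; $\tau$ denotes a generic random variable with this distribution, $\mathbb{E}[\tau]$ its mean and $\mathbb{V}(\tau)$ its variance. On a probability space, the random variables $(R_{l,j},\tau_{l,j})_{l\ge1,j\in\mathcal{A}}$ are mutually independent, $R_{l,j}\sim\zeta_j$ and $\tau_{l,j}$ has the delay distribution. If the player chooses arm $J_l$ in round $l$, then at the end of round $t$ it observes only $X_t=\sum_{l=1}^t R_{l,J_l}\mathbf{1}\{l+\tau_{l,J_l}=t\}$. The horizon $T$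 is known. The pseudo-regret is $\mathrm{Reg}_T=\sum_{t=1}^T(\mu^*-\mu_{J_t})$. Algorithm ODAAF with a strictly increasing sequence of positive integers $(n_m)_{m\ge1}$, $n_0=0$: it runs phases $m=1,2,\dots$ while the round index $t\le T$, with tolerance $\tilde\Delta_m=2^{-m}$, active sets $\mathcal{A}_1=\mathcal{A}$ and index sets $T_j(0)=\emptyset$. In phase $m$: (1) for each $j\in\mathcal{A}_m$, in a fixed order, set $T_j(m)=T_j(m-1)$ and play arm $j$ in consecutive rounds, adding each such round index to $T_j(m)$, until $|T_j(m)|=n_m$ (i.e. $n_m-n_{m-1}$ consecutive plays), stopping if round $T$ is reached; (2) for $j\in\mathcal{A}_m$ compute $\bar X_{m,j}=|T_j(m)|^{-1}\sum_{t\in T_j(m)}X_t$ and set $\mathcal{A}_{m+1}=\{j\in\mathcal{A}_m:\bar X_{m,j}+\tilde\Delta_m\ge\max_{j'\in\mathcal{A}_m}\bar X_{m,j'}\}$; (3) bridge period: pick an arm of $\mathcal{A}_{m+1}$ and play it for $n_m-n_{m-1}$ consecutive rounds (stopping at $T$); these rounds are not added to any $T_j(m)$ and their observations are discarded. Write $L_m=\log(T\tilde\Delta_m^2)$. Choice (N1): $n_m=\Big\lceil\tilde\Delta_m^{-2}\Big(\sqrt{2L_m}+\sqrt{2L_m+\tfrac83\tilde\Delta_mL_m+6\tilde\Delta_m m\,\mathbb{E}[\tau]}\Big)^2\Big\rceil$. Assumption 1: $\mathbb{E}[\tau]<\infty$ and its value is known to the algorithm.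
   Formalization: The bound is proved under the added condition T·Δ_j² ≥ 1 for every suboptimal arm j (all logarithms log(TΔ_j²) nonnegative); without it the right-hand side can be negative, e.g. T=5, K=2, Δ_2=0.01, no delay, and the claim fails. *)

theory Defs
  imports "HOL-Probability.Probability"
begin

text \<open>Phase lengths, choice (N1).  Rounds and phases are 1-indexed; n 0 = 0.
  T is the horizon, Etau the (known) mean delay.  L_m = ln (T * 2^(-2m)).\<close>

definition odaaf_L :: "nat \<Rightarrow> nat \<Rightarrow> real" where
  "odaaf_L T m = ln (real T * (2 powr (- real m))\<^sup>2)"

definition odaaf_n :: "nat \<Rightarrow> real \<Rightarrow> nat \<Rightarrow> nat" where
  "odaaf_n T Etau m =
     (if m = 0 then 0 else
      (let D = 2 powr (- real m); L = odaaf_L T m in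
        nat \<lceil>(1 / D\<^sup>2) *
             (sqrt (2 * L) + sqrt (2 * L + 8 / 3 * D * L + 6 * D * real m * Etau))\<^sup>2\<rceil>))"

text \<open>Aggregated anonymous observation at the end of round t, given the realised
  rewards r l j, delays d l j and the arm J l played in each round l.\<close>

definition obs :: "(nat \<Rightarrow> nat \<Rightarrow> real) \<Rightarrow> (nat \<Rightarrow> nat \<Rightarrow> nat) \<Rightarrow> (nat \<Rightarrow> nat) \<Rightarrow> nat \<Rightarrow> real" where
  "obs r d J t = (\<Sum>l\<in>{1..t}. if l + d l (J l) = t then r l (J l) else 0)"

text \<open>State before a phase: active set, number of rounds used so far, arms played in
  the rounds used so far, and the index sets T_j.\<close>

type_synonym odaaf_state = "nat set \<times> nat \<times> (nat \<Rightarrow> nat) \<times> (nat \<Rightarrow> nat set)"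

definition odaaf_phase ::
  "(nat \<Rightarrow> nat) \<Rightarrow> (nat \<Rightarrow> nat \<Rightarrow> real) \<Rightarrow> (nat \<Rightarrow> nat \<Rightarrow> nat) \<Rightarrow> nat \<Rightarrow> odaaf_state \<Rightarrow> odaaf_state" where
  "odaaf_phase nseq r d ph st =
     (case st of (A, s, J, Ts) \<Rightarrow>
       (let b = nseq ph - nseq (ph - 1);
            as = sorted_list_of_set A;
            e = s + length as * b;
            J' = (\<lambda>t. if s < t \<and> t \<le> e then as ! ((t - s - 1) div b) else J t);
            Ts' = (\<lambda>j. if j \<in> A then Ts j \<union> {t. s < t \<and> t \<le> e \<and> J' t = j} else Ts j);
            Xbar = (\<lambda>j. (\<Sum>t\<in>Ts' j. obs r d J' t) / real (card (Ts' j)));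
            A' = {j \<in> A. Xbar j + 2 powr (- real ph) \<ge> Max (Xbar ` A)}
        in (A', e, J', Ts')))"

primrec odaaf_states ::
  "nat \<Rightarrow> (nat \<Rightarrow> nat) \<Rightarrow> (nat \<Rightarrow> nat \<Rightarrow> real) \<Rightarrow> (nat \<Rightarrow> nat \<Rightarrow> nat) \<Rightarrow> nat \<Rightarrow> odaaf_state" where
  "odaaf_states K nseq r d 0 = ({1..K}, 0, (\<lambda>_. 0), (\<lambda>_. {}))"
| "odaaf_states K nseq r d (Suc m) = odaaf_phase nseq r d (Suc m) (odaaf_states K nseq r d m)"

text \<open>Arm played in round t: read off after the first phase that covers round t.
  (Rounds after the horizon do not influence rounds up to the horizon, so running
  the phases without the cut-off at T yields the same arms in rounds 1..T.)\<close>

definition odaaf_arm ::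
  "nat \<Rightarrow> (nat \<Rightarrow> nat) \<Rightarrow> (nat \<Rightarrow> nat \<Rightarrow> real) \<Rightarrow> (nat \<Rightarrow> nat \<Rightarrow> nat) \<Rightarrow> nat \<Rightarrow> nat" where
  "odaaf_arm K nseq r d t =
     (if \<exists>m. t \<le> fst (snd (odaaf_states K nseq r d m))
      then fst (snd (snd (odaaf_states K nseq r d
              (LEAST m. t \<le> fst (snd (odaaf_states K nseq r d m)))))) t
      else 1)"

end

theory Submission
  imports Defs
begin

text \<open>
  Condition on the state at the start of a phase: the arms of the phase are then fixed, and the
  rewards and delays of its rounds are fresh.  Hence exponential weights built phase by phase are
  supermartingales, although the start of a block is random.  The sum of the observations in the
  blocks of an arm \<open>j\<close> exceeds the sum of its rewards by at most the number of foreign plays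
  pending at the start of a block or at the end of a phase.  Their waiting times within a phase are
  distinct on each side of the block, so each phase contributes at most \<open>2 E[\<tau>]\<close> in mean.  With
  \<open>D = 2\<^sup>-\<^sup>m\<close>, (N1) gives \<open>n\<^sub>m D\<^sup>2 \<ge> 8 L\<^sub>m + 6 D m E[\<tau>]\<close>, and the Chernoff
  bound with parameter \<open>D / 2\<close> makes each estimate bad with probability at most \<open>4\<^sup>m / T\<close>.

  While no estimate is bad, an arm of gap \<open>\<Delta>\<close> is gone after the first phase with
  \<open>19/10 D < \<Delta>\<close>.  If phase \<open>m\<close> is the first bad one, the arms that are late have gap at most
  \<open>19/5 D\<close>, so the loss \<open>19/5 D T\<close> times \<open>4\<^sup>m / T\<close> is geometric in \<open>m\<close>.  Arms with
  \<open>T \<Delta>\<^sup>2 \<le> 400\<close> cost at most \<open>T \<Delta> \<le> 400 / \<Delta>\<close>; the others need only phases with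
  \<open>L\<^sub>m \<ge> ln 4\<close>, where (N1) is increasing.
\<close>

section \<open>Supermartingales over phases of random length\<close>

text \<open>Two union bounds would be too expensive. The regret bound has no term for optimal arms,
  so failures of optimal arms may not be summed over them; hence one martingale runs along a
  predictable optimal arm that may change between phases. And if every suboptimal arm could spoil
  every phase, each would be charged about the inverse of the smallest gap treated; hence
  overestimates of an arm are counted only in phases in which it is still due to be active. Measured
  in units of \<open>D\<close> times the number of plays, an overestimate of an observed sum may
  reach 1/2 and the deficit of the optimal arm 2/5. Together this is 9/10 < 1, so no suboptimal arm
  can eliminate the optimal arm that is followed, while 1 + 9/10 = 19/10 is the gap beyond which an
  arm must be dropped.\<close>

locale delayed_feedback = prob_space M for M :: "'a measure" +
  fixes K :: nat and R :: "nat \<Rightarrow> nat \<Rightarrow> 'a \<Rightarrow> real" and D :: "nat \<Rightarrow> nat \<Rightarrow> 'a \<Rightarrow> nat"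
  assumes R_meas [measurable]: "\<And>l j. R l j \<in> borel_measurable M"
    and D_meas [measurable]: "\<And>l j. D l j \<in> measurable M (count_space UNIV)"
    and indep: "indep_vars (\<lambda>_. borel)
        (\<lambda>(b, l, j). if b then R l j else (\<lambda>\<omega>. real (D l j \<omega>)))
        (UNIV \<times> {1..} \<times> {1..K})"
begin

definition coord :: "bool \<times> nat \<times> nat \<Rightarrow> 'a \<Rightarrow> real" where
  "coord = (\<lambda>(b, l, j). if b then R l j else (\<lambda>\<omega>. real (D l j \<omega>)))"

abbreviation coords :: "(bool \<times> nat \<times> nat) set" where
  "coords \<equiv> UNIV \<times> {1..} \<times> {1..K}"

definition coord_events :: "bool \<times> nat \<times> nat \<Rightarrow> 'a set set" where
  "coord_events i = {coord i -` B \<inter> space M |B. B \<in> sets borel}"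

definition gen :: "(bool \<times> nat \<times> nat) set \<Rightarrow> 'a measure" where
  "gen I = sigma (space M) (\<Union>i\<in>I. coord_events i)"

text \<open>Richer than what the player sees: it contains the rewards and delays of all arms in the
  first \<open>s\<close> rounds, also delays that have not yet elapsed. Play is still adapted to it,
  and the coordinates of later rounds are independent of it.\<close>

definition hist :: "nat \<Rightarrow> 'a measure" where
  "hist s = gen (UNIV \<times> {1..s} \<times> {1..K})"

lemma coord_measurable: "coord i \<in> borel_measurable M"
  by (cases i) (auto simp: coord_def)

lemma coord_events_subset: "coord_events i \<subseteq> sets M"
  using coord_measurable[of i] by (auto simp: coord_events_def)

lemma space_gen [simp]: "space (gen I) = space M"
  by (simp add: gen_def space_measure_of_conv)

lemma sets_gen: "sets (gen I) = sigma_sets (space M) (\<Union>i\<in>I. coord_events i)"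
  unfolding gen_def using coord_events_subset sets.sets_into_space by (intro sets_measure_of) blast

lemma sets_gen_subset: "sets (gen I) \<subseteq> sets M"
  unfolding sets_gen using coord_events_subset by (intro sets.sigma_sets_subset) auto

lemma sets_gen_mono: "I \<subseteq> J \<Longrightarrow> sets (gen I) \<subseteq> sets (gen J)"
  unfolding sets_gen by (intro sigma_sets_mono') auto

lemma measurable_gen_mono:
  assumes "f \<in> measurable (gen I) N" "I \<subseteq> J"
  shows "f \<in> measurable (gen J) N"
  using measurable_mono[OF order_refl refl sets_gen_mono[OF assms(2)], where N = N] assms(1) by auto

lemma measurable_gen_imp: "f \<in> measurable (gen I) N \<Longrightarrow> f \<in> measurable M N"
  using measurable_mono[OF order_refl refl sets_gen_subset, where N = N] by auto

lemma coord_gen: "i \<in> I \<Longrightarrow> coord i \<in> borel_measurable (gen I)"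
proof (rule measurableI)
  fix B :: "real set" assume "i \<in> I" "B \<in> sets borel"
  then show "coord i -` B \<inter> space (gen I) \<in> sets (gen I)"
    unfolding sets_gen by (intro sigma_sets.Basic) (auto simp: coord_events_def)
qed simp

lemma R_gen: "(True, l, j) \<in> I \<Longrightarrow> R l j \<in> borel_measurable (gen I)"
  using coord_gen[of "(True, l, j)" I] by (simp add: coord_def)

lemma D_gen:
  assumes "(False, l, j) \<in> I"
  shows "D l j \<in> measurable (gen I) (count_space UNIV)"
proof -
  have "(\<lambda>\<omega>. real (D l j \<omega>)) \<in> borel_measurable (gen I)"
    using coord_gen[OF assms] by (simp add: coord_def)
  \<comment> \<open>Independence is stated for delays cast to reals; the floor recovers the natural
    number measurably.\<close>
  then have "(\<lambda>\<omega>. nat \<lfloor>real (D l j \<omega>)\<rfloor>) \<in> measurable (gen I) (count_space UNIV)"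
    by measurable
  then show ?thesis by simp
qed

text \<open>Disjoint groups of independent coordinates generate independent sigma-algebras, so
  expectations factorise. In \<open>ennreal\<close> no integrability has to be carried
  along.\<close>

lemma nn_integral_gen_mult:
  fixes f g :: "'a \<Rightarrow> ennreal"
  assumes "I \<subseteq> coords" "J \<subseteq> coords" "I \<inter> J = {}"
    and f: "f \<in> borel_measurable (gen I)" and g: "g \<in> borel_measurable (gen J)"
  shows "(\<integral>\<^sup>+\<omega>. f \<omega> * g \<omega> \<partial>M) = (\<integral>\<^sup>+\<omega>. f \<omega> \<partial>M) * (\<integral>\<^sup>+\<omega>. g \<omega> \<partial>M)"
proof -
  let ?B = "\<lambda>b. if b then I else J" and ?S = "\<lambda>b. if b then f else g"
  have ind: "indep_sets (\<lambda>b. sigma_sets (space M) (\<Union>i\<in>?B b. coord_events i)) UNIV"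
  proof (rule indep_sets_collect_sigma)
    have "indep_sets coord_events coords"
      using indep unfolding indep_vars_def2 coord_events_def coord_def by simp
    then show "indep_sets coord_events (\<Union>b\<in>UNIV. ?B b)"
      by (rule indep_sets_mono_index[rotated]) (use assms(1,2) in \<open>simp add: UNIV_bool\<close>)
    show "disjoint_family ?B"
      using assms(3) by (auto simp: disjoint_family_on_def)
    show "Int_stable (coord_events i)" for i
    proof (rule Int_stableI)
      fix a b assume "a \<in> coord_events i" "b \<in> coord_events i"
      then obtain A B where "a = coord i -` A \<inter> space M" "b = coord i -` B \<inter> space M"
        "A \<in> sets borel" "B \<in> sets borel" by (auto simp: coord_events_def)
      then have "a \<inter> b = coord i -` (A \<inter> B) \<inter> space M" "A \<inter> B \<in> sets borel" by auto
      then show "a \<inter> b \<in> coord_events i" unfolding coord_events_def by blast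
    qed
  qed
  have "indep_vars (\<lambda>_. borel) ?S UNIV"
    unfolding indep_vars_def2
  proof
    show "\<forall>b\<in>UNIV. random_variable borel (?S b)"
      using f g by (auto intro: measurable_gen_imp)
    show "indep_sets (\<lambda>b. {?S b -` A \<inter> space M |A. A \<in> sets borel}) UNIV"
    proof (rule indep_sets_mono_sets[OF ind])
      fix b :: bool
      show "{?S b -` A \<inter> space M |A. A \<in> sets borel} \<subseteq> sigma_sets (space M) (\<Union>i\<in>?B b. coord_events i)"
        using measurable_sets[OF f] measurable_sets[OF g] by (auto simp: sets_gen)
    qed
  qed
  from indep_vars_nn_integral[OF _ this] show ?thesis
    by (simp add: UNIV_bool mult.commute)
qed

text \<open>Each factor depends only on the reward and delay of its own round, which are independent
  of the history so far, so it leaves the integral as a mean of at most 1. Measurability in the new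
  history is part of the claim because the next round needs it. Start and arms are deterministic
  here; splitting on the state will reduce the random case to this one.\<close>

lemma nn_integral_block:
  fixes Y :: "'a \<Rightarrow> ennreal" and g :: "nat \<Rightarrow> real \<Rightarrow> nat \<Rightarrow> ennreal" and arm :: "nat \<Rightarrow> nat"
  assumes Y: "Y \<in> borel_measurable (hist s)"
    and g: "\<And>l d. (\<lambda>r. g l r d) \<in> borel_measurable borel"
    and arm: "\<And>l. s < l \<Longrightarrow> l \<le> s + n \<Longrightarrow> arm l \<in> {1..K}"
    and le1: "\<And>l. s < l \<Longrightarrow> l \<le> s + n \<Longrightarrow> (\<integral>\<^sup>+\<omega>. g l (R l (arm l) \<omega>) (D l (arm l) \<omega>) \<partial>M) \<le> 1"
  shows "(\<lambda>\<omega>. Y \<omega> * (\<Prod>l\<in>{s<..s+n}. g l (R l (arm l) \<omega>) (D l (arm l) \<omega>))) \<in> borel_measurable (hist (s + n)) \<and>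
     (\<integral>\<^sup>+\<omega>. Y \<omega> * (\<Prod>l\<in>{s<..s+n}. g l (R l (arm l) \<omega>) (D l (arm l) \<omega>)) \<partial>M) \<le> (\<integral>\<^sup>+\<omega>. Y \<omega> \<partial>M)"
  using arm le1
proof (induction n)
  case 0
  then show ?case using Y by simp
next
  case (Suc n)
  let ?a = "arm (Suc (s + n))"
  let ?h = "\<lambda>l \<omega>. g l (R l (arm l) \<omega>) (D l (arm l) \<omega>)"
  let ?I = "UNIV \<times> {Suc (s + n)} \<times> {?a}"
  define Z where "Z = (\<lambda>\<omega>. Y \<omega> * (\<Prod>l\<in>{s<..s+n}. ?h l \<omega>))"
  have Z: "Z \<in> borel_measurable (hist (s + n))" and ZY: "(\<integral>\<^sup>+\<omega>. Z \<omega> \<partial>M) \<le> (\<integral>\<^sup>+\<omega>. Y \<omega> \<partial>M)"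
    using Suc by (auto simp: Z_def)
  have a: "?a \<in> {1..K}" using Suc.prems by simp
  have split: "Y \<omega> * (\<Prod>l\<in>{s<..s+Suc n}. ?h l \<omega>) = Z \<omega> * ?h (Suc (s + n)) \<omega>" for \<omega>
  proof -
    have "{s<..s+Suc n} = insert (Suc (s + n)) {s<..s+n}" by auto
    then show ?thesis by (simp add: Z_def mult_ac)
  qed
  have [measurable]: "R (Suc (s + n)) ?a \<in> borel_measurable (gen ?I)"
      "D (Suc (s + n)) ?a \<in> measurable (gen ?I) (count_space UNIV)"
    by (auto intro!: R_gen D_gen)
  have h: "?h (Suc (s + n)) \<in> borel_measurable (gen ?I)"
  proof (rule measurable_compose_countable[where f = "\<lambda>d \<omega>. g (Suc (s + n)) (R (Suc (s + n)) ?a \<omega>) d"])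
    show "(\<lambda>\<omega>. g (Suc (s + n)) (R (Suc (s + n)) ?a \<omega>) d) \<in> borel_measurable (gen ?I)" for d
      by (rule measurable_compose[OF _ g]) measurable
  qed measurable
  have "Z \<in> borel_measurable (hist (s + Suc n))"
    using Z unfolding hist_def by (rule measurable_gen_mono) auto
  moreover have "?h (Suc (s + n)) \<in> borel_measurable (hist (s + Suc n))"
    using h unfolding hist_def by (rule measurable_gen_mono) (use a in auto)
  ultimately have meas: "(\<lambda>\<omega>. Z \<omega> * ?h (Suc (s + n)) \<omega>) \<in> borel_measurable (hist (s + Suc n))"
    by measurable
  have "(\<integral>\<^sup>+\<omega>. Z \<omega> * ?h (Suc (s + n)) \<omega> \<partial>M) = (\<integral>\<^sup>+\<omega>. Z \<omega> \<partial>M) * (\<integral>\<^sup>+\<omega>. ?h (Suc (s + n)) \<omega> \<partial>M)"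
    by (rule nn_integral_gen_mult[OF _ _ _ Z[unfolded hist_def] h]) (use a in auto)
  also have "\<dots> \<le> (\<integral>\<^sup>+\<omega>. Y \<omega> \<partial>M) * 1"
    using ZY Suc.prems by (intro mult_mono) auto
  finally show ?case
    unfolding split using meas by simp
qed

end

text \<open>Optional stopping for an exponential supermartingale that advances phase by phase.  The
  state \<open>q k\<close> at the start of a phase fixes the arms played in the phase and takes finitely many
  values, so the expectation can be split according to its value.\<close>

locale phased_play = delayed_feedback +
  fixes q :: "nat \<Rightarrow> 'a \<Rightarrow> 'q" and len :: "nat \<Rightarrow> 'q \<Rightarrow> nat" and pos :: "'q \<Rightarrow> nat"
    and arm :: "'q \<Rightarrow> nat \<Rightarrow> nat \<Rightarrow> nat"
    and step :: "nat \<Rightarrow> 'q \<Rightarrow> 'a \<Rightarrow> 'q"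
  assumes fin0: "\<exists>x. \<forall>\<omega>\<in>space M. q 0 \<omega> = x"
    and q_Suc: "\<And>k \<omega>. \<omega> \<in> space M \<Longrightarrow> q (Suc k) \<omega> = step k (q k \<omega>) \<omega>"
    and fin_step: "\<And>k \<omega>. \<omega> \<in> space M \<Longrightarrow> finite (step k (q k \<omega>) ` space M)"
    and pos_step: "\<And>k x \<omega>. pos (step k x \<omega>) = pos x + len k x"
    and step_meas: "\<And>k \<omega> y. \<omega> \<in> space M \<Longrightarrow>
        {\<omega>' \<in> space M. step k (q k \<omega>) \<omega>' = y} \<in> sets (hist (pos (q k \<omega>) + len k (q k \<omega>)))"
    and arm: "\<And>k \<omega> l. \<omega> \<in> space M \<Longrightarrow> pos (q k \<omega>) < l \<Longrightarrow> l \<le> pos (q k \<omega>) + len k (q k \<omega>)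
        \<Longrightarrow> arm (q k \<omega>) k l \<in> {1..K}"
begin

lemma finite_range_q: "finite (q k ` space M)"
proof (induction k)
  case 0
  obtain x where "\<forall>\<omega>\<in>space M. q 0 \<omega> = x" using fin0 by blast
  then have "q 0 ` space M \<subseteq> {x}" by auto
  then show ?case using finite_subset by blast
next
  case (Suc k)
  have "q (Suc k) ` space M \<subseteq> (\<Union>x\<in>q k ` space M. step k x ` space M)"
    using q_Suc by auto
  moreover have "finite (\<Union>x\<in>q k ` space M. step k x ` space M)"
    by (rule finite_UN_I[OF Suc]) (use fin_step in auto)
  ultimately show ?case using finite_subset by blast
qed

text \<open>The round counter is part of the state, so \<open>pos\<close> acts like a stopping time:
  the first \<open>pos x\<close> rounds decide whether \<open>x\<close> was reached. Only
  predecessors whose phase ends at \<open>pos x\<close> can lead to \<open>x\<close>.\<close>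

lemma q_meas: "{\<omega> \<in> space M. q k \<omega> = x} \<in> sets (hist (pos x))"
proof (induction k arbitrary: x)
  case 0
  obtain y where "\<forall>\<omega>\<in>space M. q 0 \<omega> = y" using fin0 by blast
  then have "{\<omega> \<in> space M. q 0 \<omega> = x} = (if x = y then space M else {})" by auto
  then show ?case using sets.top[of "hist (pos x)"] by (auto simp: hist_def)
next
  case (Suc k)
  have eq: "{\<omega> \<in> space M. q (Suc k) \<omega> = x} =
     (\<Union>y\<in>{y \<in> q k ` space M. pos y + len k y = pos x}.
        {\<omega> \<in> space M. q k \<omega> = y} \<inter> {\<omega> \<in> space M. step k y \<omega> = x})"
    using q_Suc pos_step by fastforce
  show ?case
    unfolding eq
  proof (rule sets.finite_UN)
    fix y assume y: "y \<in> {y \<in> q k ` space M. pos y + len k y = pos x}"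
    have "{\<omega> \<in> space M. q k \<omega> = y} \<in> sets (hist (pos x))"
      using Suc.IH[of y] y sets_gen_mono[of "UNIV \<times> {1..pos y} \<times> {1..K}" "UNIV \<times> {1..pos x} \<times> {1..K}"]
      unfolding hist_def by fastforce
    moreover have "{\<omega> \<in> space M. step k y \<omega> = x} \<in> sets (hist (pos x))"
      using y step_meas[of _ k x] by fastforce
    ultimately show "{\<omega> \<in> space M. q k \<omega> = y} \<inter> {\<omega> \<in> space M. step k y \<omega> = x} \<in> sets (hist (pos x))"
      by blast
  qed (use finite_range_q in auto)
qed

fun weight :: "(nat \<Rightarrow> 'q \<Rightarrow> nat \<Rightarrow> real \<Rightarrow> nat \<Rightarrow> ennreal) \<Rightarrow> nat \<Rightarrow> 'a \<Rightarrow> ennreal" where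
  "weight g 0 \<omega> = 1"
| "weight g (Suc k) \<omega> = weight g k \<omega> *
     (\<Prod>l\<in>{pos (q k \<omega>)<..pos (q k \<omega>) + len k (q k \<omega>)}.
        g k (q k \<omega>) l (R l (arm (q k \<omega>) k l) \<omega>) (D l (arm (q k \<omega>) k l) \<omega>))"

text \<open>The weight is a product over a random set of rounds. Cut down to one value
  \<open>x\<close> of the state it is measurable in the deterministic history
  \<open>hist (pos x)\<close>, and \<open>nn_integral_block\<close> applies; summing over the
  finitely many values restores the whole. The localised measurability is what the next phase
  consumes, so all claims share one induction.\<close>

lemma nn_integral_weight:
  fixes g :: "nat \<Rightarrow> 'q \<Rightarrow> nat \<Rightarrow> real \<Rightarrow> nat \<Rightarrow> ennreal"
  assumes g: "\<And>k x l d. (\<lambda>r. g k x l r d) \<in> borel_measurable borel"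
    and le1: "\<And>k x l a. l \<ge> 1 \<Longrightarrow> a \<in> {1..K} \<Longrightarrow> a = arm x k l \<Longrightarrow>
       (\<integral>\<^sup>+\<omega>. g k x l (R l a \<omega>) (D l a \<omega>) \<partial>M) \<le> 1"
  shows "(\<forall>x. (\<lambda>\<omega>. indicator {\<omega> \<in> space M. q k \<omega> = x} \<omega> * weight g k \<omega>) \<in> borel_measurable (hist (pos x)))
     \<and> weight g k \<in> borel_measurable M \<and> (\<integral>\<^sup>+\<omega>. weight g k \<omega> \<partial>M) \<le> 1"
proof (induction k)
  case 0
  have "(\<lambda>\<omega>. indicator {\<omega> \<in> space M. q 0 \<omega> = x} \<omega> :: ennreal) \<in> borel_measurable (hist (pos x))" for x
    using q_meas by measurable
  then show ?case by (simp add: emeasure_space_1)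
next
  case (Suc k)
  let ?Q = "q k ` space M"
  let ?Y = "\<lambda>x \<omega>. indicator {\<omega> \<in> space M. q k \<omega> = x} \<omega> * weight g k \<omega>"
  let ?Z = "\<lambda>x \<omega>. ?Y x \<omega> * (\<Prod>l\<in>{pos x<..pos x + len k x}. g k x l (R l (arm x k l) \<omega>) (D l (arm x k l) \<omega>))"
  have Y: "?Y x \<in> borel_measurable (hist (pos x))" for x using Suc by blast
  have block: "?Z x \<in> borel_measurable (hist (pos x + len k x)) \<and> (\<integral>\<^sup>+\<omega>. ?Z x \<omega> \<partial>M) \<le> (\<integral>\<^sup>+\<omega>. ?Y x \<omega> \<partial>M)"
    if x: "x \<in> ?Q" for x
  proof (rule nn_integral_block[where g = "g k x" and arm = "arm x k", OF Y g])
    obtain \<omega> where "\<omega> \<in> space M" "x = q k \<omega>" using x by blast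
    then show a: "arm x k l \<in> {1..K}" if "pos x < l" "l \<le> pos x + len k x" for l
      using arm that by blast
    show "(\<integral>\<^sup>+\<omega>. g k x l (R l (arm x k l) \<omega>) (D l (arm x k l) \<omega>) \<partial>M) \<le> 1"
      if "pos x < l" "l \<le> pos x + len k x" for l
      by (rule le1) (use a[OF that] that in auto)
  qed
  have sumQ: "f (q k \<omega>) \<omega> = (\<Sum>x\<in>?Q. indicator {\<omega> \<in> space M. q k \<omega> = x} \<omega> * f x \<omega>)"
    if "\<omega> \<in> space M" for f :: "'q \<Rightarrow> 'a \<Rightarrow> ennreal" and \<omega>
  proof -
    have "(\<Sum>x\<in>?Q. indicator {\<omega> \<in> space M. q k \<omega> = x} \<omega> * f x \<omega>) = (\<Sum>x\<in>?Q. if x = q k \<omega> then f x \<omega> else 0)"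
      using that by (intro sum.cong) auto
    also have "\<dots> = f (q k \<omega>) \<omega>" using that finite_range_q by (simp add: sum.delta)
    finally show ?thesis by simp
  qed
  have wSuc: "weight g (Suc k) \<omega> = (\<Sum>x\<in>?Q. ?Z x \<omega>)" if "\<omega> \<in> space M" for \<omega>
    using sumQ[OF that, of "\<lambda>x \<omega>. weight g k \<omega> * (\<Prod>l\<in>{pos x<..pos x + len k x}. g k x l (R l (arm x k l) \<omega>) (D l (arm x k l) \<omega>))"]
    by (simp add: mult.assoc)
  have ZM: "?Z x \<in> borel_measurable M" if "x \<in> ?Q" for x
    using block[OF that] measurable_gen_imp unfolding hist_def by blast
  have "(\<lambda>\<omega>. \<Sum>x\<in>?Q. ?Z x \<omega>) \<in> borel_measurable M"
    by (rule borel_measurable_sum) (rule ZM)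
  then have wM: "weight g (Suc k) \<in> borel_measurable M"
    by (subst measurable_cong[OF wSuc])
  have "(\<integral>\<^sup>+\<omega>. weight g (Suc k) \<omega> \<partial>M) = (\<integral>\<^sup>+\<omega>. (\<Sum>x\<in>?Q. ?Z x \<omega>) \<partial>M)"
    by (rule nn_integral_cong) (rule wSuc)
  also have "\<dots> = (\<Sum>x\<in>?Q. \<integral>\<^sup>+\<omega>. ?Z x \<omega> \<partial>M)"
    by (rule nn_integral_sum) (rule ZM)
  also have "\<dots> \<le> (\<Sum>x\<in>?Q. \<integral>\<^sup>+\<omega>. ?Y x \<omega> \<partial>M)"
    by (rule sum_mono) (use block in blast)
  also have "\<dots> = (\<integral>\<^sup>+\<omega>. (\<Sum>x\<in>?Q. ?Y x \<omega>) \<partial>M)"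
    by (rule nn_integral_sum[symmetric]) (use Y measurable_gen_imp in \<open>auto simp: hist_def\<close>)
  also have "\<dots> = (\<integral>\<^sup>+\<omega>. weight g k \<omega> \<partial>M)"
    by (rule nn_integral_cong) (use sumQ[of _ "\<lambda>_. weight g k"] in simp)
  also have "\<dots> \<le> 1" using Suc by blast
  finally have le: "(\<integral>\<^sup>+\<omega>. weight g (Suc k) \<omega> \<partial>M) \<le> 1" .
  have meas: "(\<lambda>\<omega>. indicator {\<omega> \<in> space M. q (Suc k) \<omega> = y} \<omega> * weight g (Suc k) \<omega>) \<in> borel_measurable (hist (pos y))" for y
  proof -
    let ?P = "{x \<in> ?Q. pos x + len k x = pos y}"
    have "indicator {\<omega> \<in> space M. q (Suc k) \<omega> = y} \<omega> * weight g (Suc k) \<omega> =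
      indicator {\<omega> \<in> space M. q (Suc k) \<omega> = y} \<omega> * (\<Sum>x\<in>?P. ?Z x \<omega>)" if "\<omega> \<in> space (hist (pos y))" for \<omega>
    proof (cases "q (Suc k) \<omega> = y")
      case True
      have \<omega>: "\<omega> \<in> space M" using that by (simp add: hist_def)
      \<comment> \<open>On this event the true predecessor ends its phase at \<open>pos y\<close>;
        every other summand vanishes through its indicator.\<close>
      have "(\<Sum>x\<in>?Q. ?Z x \<omega>) = (\<Sum>x\<in>?P. ?Z x \<omega>)"
      proof (rule sum.mono_neutral_right)
        have "pos (q k \<omega>) + len k (q k \<omega>) = pos y" using True q_Suc[OF \<omega>] pos_step by metis
        then show "\<forall>x\<in>?Q - ?P. ?Z x \<omega> = 0" by (auto simp: indicator_def split: if_splits)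
      qed (use finite_range_q in auto)
      then show ?thesis using wSuc[OF \<omega>] by simp
    qed simp
    moreover have "(\<lambda>\<omega>. indicator {\<omega> \<in> space M. q (Suc k) \<omega> = y} \<omega> * (\<Sum>x\<in>?P. ?Z x \<omega>)) \<in> borel_measurable (hist (pos y))"
    proof -
      have "(\<lambda>\<omega>. \<Sum>x\<in>?P. ?Z x \<omega>) \<in> borel_measurable (hist (pos y))"
        by (rule borel_measurable_sum) (use block in force)
      moreover have "(\<lambda>\<omega>. indicator {\<omega> \<in> space M. q (Suc k) \<omega> = y} \<omega> :: ennreal) \<in> borel_measurable (hist (pos y))"
        using q_meas[of "Suc k" y] by measurable
      ultimately show ?thesis by measurable
    qed
    ultimately show ?thesis by (subst measurable_cong) auto
  qed
  show ?case using meas wM le by blast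
qed

end

section \<open>Phases, blocks and observations\<close>

definition phase_len :: "(nat \<Rightarrow> nat) \<Rightarrow> nat \<Rightarrow> nat" where
  "phase_len n ph = n ph - n (ph - 1)"

definition phase_end :: "(nat \<Rightarrow> nat) \<Rightarrow> nat \<Rightarrow> odaaf_state \<Rightarrow> nat" where
  "phase_end n ph st = fst (snd st) + card (fst st) * phase_len n ph"

definition phase_arm :: "(nat \<Rightarrow> nat) \<Rightarrow> nat \<Rightarrow> odaaf_state \<Rightarrow> nat \<Rightarrow> nat" where
  "phase_arm n ph st t = sorted_list_of_set (fst st) ! ((t - fst (snd st) - 1) div phase_len n ph)"

definition phase_play :: "(nat \<Rightarrow> nat) \<Rightarrow> nat \<Rightarrow> odaaf_state \<Rightarrow> nat \<Rightarrow> nat" where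
  "phase_play n ph st t = (if fst (snd st) < t \<and> t \<le> phase_end n ph st then phase_arm n ph st t
     else fst (snd (snd st)) t)"

definition phase_idx :: "(nat \<Rightarrow> nat) \<Rightarrow> nat \<Rightarrow> odaaf_state \<Rightarrow> nat \<Rightarrow> nat set" where
  "phase_idx n ph st j = (if j \<in> fst st
     then snd (snd (snd st)) j \<union> {t. fst (snd st) < t \<and> t \<le> phase_end n ph st \<and> phase_play n ph st t = j}
     else snd (snd (snd st)) j)"

definition phase_sum ::
  "(nat \<Rightarrow> nat) \<Rightarrow> (nat \<Rightarrow> nat \<Rightarrow> real) \<Rightarrow> (nat \<Rightarrow> nat \<Rightarrow> nat) \<Rightarrow> nat \<Rightarrow> odaaf_state \<Rightarrow> nat \<Rightarrow> real" where
  "phase_sum n r d ph st j = (\<Sum>t\<in>phase_idx n ph st j. obs r d (phase_play n ph st) t)"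

text \<open>Rewards and delays enter only the new active set; end, plays and index sets of the phase
  are functions of the state at its start. This is the predictability on which the supermartingale
  rests.\<close>

lemma odaaf_phase_eq:
  "odaaf_phase n r d ph st =
    ({j \<in> fst st. phase_sum n r d ph st j / real (card (phase_idx n ph st j)) + 2 powr (- real ph) \<ge>
        Max ((\<lambda>j. phase_sum n r d ph st j / real (card (phase_idx n ph st j))) ` fst st)},
     phase_end n ph st, phase_play n ph st, phase_idx n ph st)"
proof (cases st)
  case (fields A s J Ts)
  let ?e = "s + length (sorted_list_of_set A) * (n ph - n (ph - 1))"
  have "phase_end n ph st = ?e"
    by (simp add: phase_end_def phase_len_def fields)
  moreover have "phase_play n ph st = (\<lambda>t. if s < t \<and> t \<le> ?e
      then sorted_list_of_set A ! ((t - s - 1) div (n ph - n (ph - 1))) else J t)"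
    by (rule ext) (simp only: phase_play_def phase_arm_def phase_len_def calculation, simp add: fields)
  moreover have "phase_idx n ph st = (\<lambda>j. if j \<in> A then Ts j \<union> {t. s < t \<and>
      t \<le> ?e \<and> phase_play n ph st t = j} else Ts j)"
    by (rule ext) (simp only: phase_idx_def calculation(1), simp add: fields)
  ultimately show ?thesis
    unfolding odaaf_phase_def phase_sum_def fields prod.case Let_def fst_conv snd_conv by (simp only:)
qed

text \<open>The position of the block of \<open>j\<close> within the phase, because active arms are
  played in increasing order.\<close>

definition arm_index :: "nat set \<Rightarrow> nat \<Rightarrow> nat" where
  "arm_index A j = card {i \<in> A. i < j}"

lemma arm_index_nth:
  assumes "finite A" "p < card A"
  shows "arm_index A (sorted_list_of_set A ! p) = p"
proof -
  let ?xs = "sorted_list_of_set A"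
  have len: "length ?xs = card A" and set: "set ?xs = A" using assms by auto
  have less: "?xs ! i < ?xs ! k" if "i < k" "k < card A" for i k
    using sorted_wrt_nth_less[OF strict_sorted_list_of_set that(1)] that(2) len by simp
  have mono: "?xs ! i < ?xs ! k \<longleftrightarrow> i < k" if "i < card A" "k < card A" for i k
    using less[of i k] less[of k i] that by (cases i k rule: linorder_cases) auto
  have "{i \<in> A. i < ?xs ! p} = (\<lambda>k. ?xs ! k) ` {..<p}"
  proof (intro equalityI subsetI)
    fix i assume "i \<in> {i \<in> A. i < ?xs ! p}"
    then obtain k where "k < card A" "i = ?xs ! k" "i < ?xs ! p"
      using set len by (metis (no_types, lifting) in_set_conv_nth mem_Collect_eq)
    then show "i \<in> (\<lambda>k. ?xs ! k) ` {..<p}" using mono assms by auto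
  next
    fix i assume "i \<in> (\<lambda>k. ?xs ! k) ` {..<p}"
    then obtain k where k: "k < p" "i = ?xs ! k" by auto
    then have "?xs ! k \<in> set ?xs" using assms len by (intro nth_mem) simp
    then show "i \<in> {i \<in> A. i < ?xs ! p}" using k mono[of k p] assms set by auto
  qed
  moreover have "inj_on (\<lambda>k. ?xs ! k) {..<p}"
    using assms len by (auto simp: inj_on_def nth_eq_iff_index_eq)
  ultimately show ?thesis by (simp add: arm_index_def card_image)
qed

lemma nth_arm_index:
  assumes "finite A" "j \<in> A"
  shows "arm_index A j < card A" "sorted_list_of_set A ! arm_index A j = j"
proof -
  obtain p where "p < card A" "sorted_list_of_set A ! p = j"
    using assms by (metis in_set_conv_nth length_sorted_list_of_set set_sorted_list_of_set)
  then show "arm_index A j < card A" "sorted_list_of_set A ! arm_index A j = j"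
    using arm_index_nth[OF assms(1)] by auto
qed

text \<open>The last round before the block: the block itself is the half-open interval of length
  \<open>phase_len\<close> that excludes this round.\<close>

definition block_start :: "(nat \<Rightarrow> nat) \<Rightarrow> nat \<Rightarrow> odaaf_state \<Rightarrow> nat \<Rightarrow> nat" where
  "block_start n ph st j = fst (snd st) + arm_index (fst st) j * phase_len n ph"

lemma block_start_ge: "fst (snd st) \<le> block_start n ph st j"
  by (simp add: block_start_def)

lemma block_end_le:
  assumes "finite (fst st)" "j \<in> fst st"
  shows "block_start n ph st j + phase_len n ph \<le> phase_end n ph st"
proof -
  have "Suc (arm_index (fst st) j) * phase_len n ph \<le> card (fst st) * phase_len n ph"
    using nth_arm_index(1)[OF assms] by (intro mult_right_mono) auto
  then show ?thesis by (simp add: block_start_def phase_end_def)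
qed

lemma phase_arm_index:
  assumes "fst (snd st) < t" "t \<le> phase_end n ph st"
  shows "(t - fst (snd st) - 1) div phase_len n ph < card (fst st)"
proof -
  have "t - fst (snd st) - 1 < card (fst st) * phase_len n ph"
    using assms by (simp add: phase_end_def)
  then show ?thesis by (simp add: less_mult_imp_div_less)
qed

lemma phase_arm_in:
  assumes "finite (fst st)" "fst (snd st) < t" "t \<le> phase_end n ph st"
  shows "phase_arm n ph st t \<in> fst st"
proof -
  have "sorted_list_of_set (fst st) ! ((t - fst (snd st) - 1) div phase_len n ph) \<in> set (sorted_list_of_set (fst st))"
    using phase_arm_index[OF assms(2,3)] assms(1) by (intro nth_mem) simp
  then show ?thesis using assms(1) by (simp add: phase_arm_def)
qed

lemma phase_arm_eq_iff:
  assumes fin: "finite (fst st)" and j: "j \<in> fst st" and t: "fst (snd st) < t" "t \<le> phase_end n ph st"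
  shows "phase_arm n ph st t = j \<longleftrightarrow> block_start n ph st j < t \<and> t \<le> block_start n ph st j + phase_len n ph"
proof -
  let ?b = "phase_len n ph" and ?p = "arm_index (fst st) j" and ?u = "t - fst (snd st) - 1"
  have b: "?b > 0" using t by (cases "?b = 0") (auto simp: phase_end_def)
  have "phase_arm n ph st t = j \<longleftrightarrow> ?u div ?b = ?p"
    unfolding phase_arm_def
    using arm_index_nth[OF fin phase_arm_index[OF t]] nth_arm_index[OF fin j] by auto
  also have "\<dots> \<longleftrightarrow> ?p * ?b \<le> ?u \<and> ?u < Suc ?p * ?b"
    using less_eq_div_iff_mult_less_eq[OF b, of ?p ?u] div_less_iff_less_mult[OF b, of ?u "Suc ?p"] by auto
  also have "\<dots> \<longleftrightarrow> block_start n ph st j < t \<and> t \<le> block_start n ph st j + ?b"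
    using t by (auto simp: block_start_def)
  finally show ?thesis .
qed

lemma obs_cong:
  assumes "\<And>l. l \<in> {1..t} \<Longrightarrow> J l = J' l"
  shows "obs r d J t = obs r d J' t"
  unfolding obs_def by (intro sum.cong) (use assms in auto)

text \<open>Each reward arrives in exactly one round, so swapping the sums regroups the observations
  by the round of play. Plays after \<open>s\<close> arrive too late to matter.\<close>

lemma sum_obs_eq:
  assumes "X \<subseteq> {1..s}"
  shows "(\<Sum>t\<in>X. obs r d J t) = (\<Sum>l\<in>{1..s}. if l + d l (J l) \<in> X then r l (J l) else 0)"
proof -
  have fin: "finite X" using assms finite_subset by blast
  have "(\<Sum>t\<in>X. obs r d J t) = (\<Sum>t\<in>X. \<Sum>l\<in>{1..s}. if l + d l (J l) = t then r l (J l) else 0)"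
  proof (rule sum.cong[OF refl])
    fix t assume "t \<in> X"
    then show "obs r d J t = (\<Sum>l\<in>{1..s}. if l + d l (J l) = t then r l (J l) else 0)"
      unfolding obs_def using assms by (intro sum.mono_neutral_left) auto
  qed
  also have "\<dots> = (\<Sum>l\<in>{1..s}. \<Sum>t\<in>X. if l + d l (J l) = t then r l (J l) else 0)"
    by (rule sum.swap)
  also have "\<dots> = (\<Sum>l\<in>{1..s}. if l + d l (J l) \<in> X then r l (J l) else 0)"
    using fin by (simp add: sum.delta)
  finally show ?thesis .
qed

section \<open>The run for fixed rewards and delays\<close>

locale odaaf_run =
  fixes K :: nat and n :: "nat \<Rightarrow> nat" and r :: "nat \<Rightarrow> nat \<Rightarrow> real" and d :: "nat \<Rightarrow> nat \<Rightarrow> nat"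
  assumes K_pos: "K \<ge> 1"
begin

text \<open>The index counts completed phases: \<open>state m\<close> is the state at the start of
  phase \<open>m + 1\<close>, and sums over \<open>k < m\<close> run over the phases 1 to
  \<open>m\<close>.\<close>

definition state :: "nat \<Rightarrow> odaaf_state" where "state m = odaaf_states K n r d m"
definition active :: "nat \<Rightarrow> nat set" where "active m = fst (state m)"
definition rounds :: "nat \<Rightarrow> nat" where "rounds m = fst (snd (state m))"
definition played :: "nat \<Rightarrow> nat \<Rightarrow> nat" where "played m = fst (snd (snd (state m)))"
definition idx :: "nat \<Rightarrow> nat \<Rightarrow> nat set" where "idx m = snd (snd (snd (state m)))"
definition total :: "nat \<Rightarrow> nat \<Rightarrow> real" where "total m j = (\<Sum>t\<in>idx m j. obs r d (played m) t)"

lemma state_Suc: "state (Suc m) = odaaf_phase n r d (Suc m) (state m)"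
  by (simp add: state_def)

lemma active_0: "active 0 = {1..K}" and rounds_0: "rounds 0 = 0" and idx_0: "idx 0 j = {}"
  by (simp_all add: active_def rounds_def idx_def state_def)

lemma rounds_Suc: "rounds (Suc m) = phase_end n (Suc m) (state m)"
  and played_Suc: "played (Suc m) = phase_play n (Suc m) (state m)"
  and idx_Suc: "idx (Suc m) = phase_idx n (Suc m) (state m)"
  by (simp_all add: rounds_def played_def idx_def state_Suc odaaf_phase_eq)

lemma total_Suc: "total (Suc m) j = phase_sum n r d (Suc m) (state m) j"
  by (simp add: total_def phase_sum_def idx_Suc played_Suc)

lemma active_Suc: "active (Suc m) = {j \<in> active m. total (Suc m) j / real (card (idx (Suc m) j)) + 2 powr (- real (Suc m))
    \<ge> Max ((\<lambda>j. total (Suc m) j / real (card (idx (Suc m) j))) ` active m)}"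
  unfolding active_def state_Suc odaaf_phase_eq total_Suc idx_Suc by simp

lemma active_decreasing: "m \<le> m' \<Longrightarrow> active m' \<subseteq> active m"
  by (induction rule: dec_induct) (auto simp: active_Suc)

lemma active_subset: "active m \<subseteq> {1..K}"
  using active_decreasing[of 0 m] by (simp add: active_0)

lemma finite_active: "finite (active m)"
  using active_subset finite_subset by blast

lemma active_nonempty: "active m \<noteq> {}"
proof (induction m)
  case 0
  then show ?case using K_pos by (simp add: active_0)
next
  case (Suc m)
  let ?X = "\<lambda>j. total (Suc m) j / real (card (idx (Suc m) j))"
  have "Max (?X ` active m) \<in> ?X ` active m"
    using Suc finite_active by (intro Max_in) auto
  then obtain j where "j \<in> active m" "?X j = Max (?X ` active m)" by auto
  then have "j \<in> active (Suc m)" by (simp add: active_Suc)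
  then show ?case by auto
qed

lemma rounds_Suc_card: "rounds (Suc m) = rounds m + card (active m) * phase_len n (Suc m)"
  unfolding rounds_Suc by (simp add: phase_end_def rounds_def active_def)

lemma rounds_mono: "m \<le> m' \<Longrightarrow> rounds m \<le> rounds m'"
  by (induction rule: dec_induct) (auto simp: rounds_Suc_card)

text \<open>Some arm is always active, so each phase adds at least one block. Truncated subtraction
  in \<open>phase_len\<close> lets this cover decreasing steps of \<open>n\<close> as well; (N1) is
  shown to increase only while \<open>L_m >= ln 4\<close>, but the phases must cover all rounds up
  to \<open>T\<close>.\<close>

lemma rounds_ge: "n m \<le> rounds m + n 0"
proof (induction m)
  case (Suc m)
  have "card (active m) \<ge> 1"
    using active_nonempty finite_active by (simp add: Suc_leI card_gt_0_iff)
  then have "phase_len n (Suc m) \<le> card (active m) * phase_len n (Suc m)" by simp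
  moreover have "n (Suc m) \<le> n m + phase_len n (Suc m)" by (simp add: phase_len_def)
  ultimately show ?case using Suc unfolding rounds_Suc_card by linarith
qed simp

lemma played_Suc': "played (Suc m) t =
    (if rounds m < t \<and> t \<le> rounds (Suc m) then phase_arm n (Suc m) (state m) t else played m t)"
  by (simp only: played_Suc phase_play_def rounds_Suc) (simp only: rounds_def played_def)

lemma idx_Suc': "idx (Suc m) j = (if j \<in> active m
    then idx m j \<union> {t. rounds m < t \<and> t \<le> rounds (Suc m) \<and> played (Suc m) t = j} else idx m j)"
  by (simp only: idx_Suc phase_idx_def rounds_Suc played_Suc) (simp only: rounds_def active_def idx_def)

lemma played_Suc_new:
  assumes "rounds m < t" "t \<le> rounds (Suc m)"
  shows "played (Suc m) t = phase_arm n (Suc m) (state m) t"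
  using assms by (simp add: played_Suc')

lemma played_Suc_in:
  assumes "rounds m < t" "t \<le> rounds (Suc m)"
  shows "played (Suc m) t \<in> active m"
  using assms phase_arm_in[of "state m" t n "Suc m"] finite_active[of m] played_Suc_new[OF assms]
  by (simp add: active_def rounds_def[of m] rounds_Suc)

lemma played_stable: "m \<le> m' \<Longrightarrow> t \<le> rounds m \<Longrightarrow> played m' t = played m t"
proof (induction rule: dec_induct)
  case (step i)
  then have "t \<le> rounds i" using rounds_mono le_trans by blast
  then have "played (Suc i) t = played i t"
    by (simp add: played_Suc')
  then show ?case using step by simp
qed simp

lemma played_in: "t \<in> {1..rounds m} \<Longrightarrow> played m t \<in> {1..K}"
proof (induction m)
  case (Suc m)
  show ?case
  proof (cases "t \<le> rounds m")
    case True
    then show ?thesis using Suc played_stable[of m "Suc m" t] by auto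
  next
    case False
    then show ?thesis using played_Suc_in[of m t] Suc.prems active_subset[of m] by auto
  qed
qed (simp add: rounds_0)

text \<open>With no bridge period every round is counted, so no play of \<open>j\<close> is missing
  from its index set.\<close>

lemma idx_eq: "idx m j = {t \<in> {1..rounds m}. played m t = j}"
proof (induction m)
  case (Suc m)
  have "idx (Suc m) j = idx m j \<union> {t. rounds m < t \<and> t \<le> rounds (Suc m) \<and> played (Suc m) t = j}"
    using played_Suc_in[of m] by (auto simp: idx_Suc')
  also have "\<dots> = {t \<in> {1..rounds (Suc m)}. played (Suc m) t = j}"
    unfolding Suc using played_stable[of m "Suc m"] rounds_mono[of m "Suc m"] by fastforce
  finally show ?case .
qed (simp add: idx_0 rounds_0)

lemma finite_idx: "finite (idx m j)"
  by (simp add: idx_eq)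

definition bstart :: "nat \<Rightarrow> nat \<Rightarrow> nat" where
  "bstart m j = block_start n (Suc m) (state m) j"

lemma bstart_ge: "rounds m \<le> bstart m j"
  by (simp add: bstart_def rounds_def block_start_ge)

lemma bend_le: "j \<in> active m \<Longrightarrow> bstart m j + phase_len n (Suc m) \<le> rounds (Suc m)"
  using block_end_le[of "state m" j n "Suc m"] finite_active[of m]
  by (simp add: bstart_def rounds_Suc active_def)

lemma played_Suc_eq_iff:
  assumes "j \<in> active m" "rounds m < t" "t \<le> rounds (Suc m)"
  shows "played (Suc m) t = j \<longleftrightarrow> bstart m j < t \<and> t \<le> bstart m j + phase_len n (Suc m)"
  using phase_arm_eq_iff[of "state m" j t n "Suc m"] finite_active[of m] assms
  by (simp add: played_Suc_new bstart_def rounds_def[of m] active_def rounds_Suc)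

lemma idx_Suc_active:
  assumes "j \<in> active m"
  shows "idx (Suc m) j = idx m j \<union> {bstart m j<..bstart m j + phase_len n (Suc m)}"
proof (intro set_eqI)
  fix t
  show "t \<in> idx (Suc m) j \<longleftrightarrow> t \<in> idx m j \<union> {bstart m j<..bstart m j + phase_len n (Suc m)}"
  proof (cases "t \<le> rounds m")
    case True
    then have "\<not> bstart m j < t" using bstart_ge[of m j] by simp
    then show ?thesis using True played_stable[of m "Suc m" t] rounds_mono[of m "Suc m"]
      by (auto simp: idx_eq)
  next
    case False
    then show ?thesis using played_Suc_eq_iff[OF assms, of t] bend_le[OF assms]
      by (auto simp: idx_eq)
  qed
qed

lemma idx_Suc_inactive: "j \<notin> active m \<Longrightarrow> idx (Suc m) j = idx m j"
  by (simp add: idx_Suc')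

lemma card_idx_Suc:
  "card (idx (Suc m) j) = card (idx m j) + (if j \<in> active m then phase_len n (Suc m) else 0)"
proof (cases "j \<in> active m")
  case True
  have "idx m j \<inter> {bstart m j<..bstart m j + phase_len n (Suc m)} = {}"
    using bstart_ge[of m j] by (auto simp: idx_eq)
  then show ?thesis using True finite_idx by (simp add: idx_Suc_active card_Un_disjoint)
qed (simp add: idx_Suc_inactive)

lemma sum_phases:
  fixes f :: "nat \<Rightarrow> real"
  shows "(\<Sum>l\<in>{1..rounds m}. f l) = (\<Sum>k<m. \<Sum>l\<in>{rounds k<..rounds (Suc k)}. f l)"
proof (induction m)
  case (Suc m)
  have "{1..rounds (Suc m)} = {1..rounds m} \<union> {rounds m<..rounds (Suc m)}"
    using rounds_mono[of m "Suc m"] by auto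
  then have "(\<Sum>l\<in>{1..rounds (Suc m)}. f l) = (\<Sum>l\<in>{1..rounds m}. f l) + (\<Sum>l\<in>{rounds m<..rounds (Suc m)}. f l)"
    by (simp add: sum.union_disjoint ivl_disj_int)
  then show ?case using Suc by simp
qed (simp add: rounds_0)

end

text \<open>The least delay with which a foreign reward earned in round \<open>l\<close> may land in
  a block of \<open>j\<close>: it must last until the block of this phase if earned before it, and
  beyond the phase otherwise. The \<open>+ 1\<close> makes the thresholds of the phase positive, in
  line with the mean delay as the sum of the tail probabilities over \<open>c >= 1\<close>.\<close>

definition threshold_in :: "(nat \<Rightarrow> nat) \<Rightarrow> nat \<Rightarrow> odaaf_state \<Rightarrow> nat \<Rightarrow> nat \<Rightarrow> nat" where
  "threshold_in n ph st j l =
     (if l \<le> block_start n ph st j then block_start n ph st j else phase_end n ph st) + 1 - l"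

text \<open>The least delay with which a reward earned in the block of \<open>j\<close> arrives
  after the block. Such a reward is written off, even if a later block of \<open>j\<close> collects
  it.\<close>

definition threshold_out :: "(nat \<Rightarrow> nat) \<Rightarrow> nat \<Rightarrow> odaaf_state \<Rightarrow> nat \<Rightarrow> nat \<Rightarrow> nat" where
  "threshold_out n ph st j l = block_start n ph st j + phase_len n ph + 1 - l"

context odaaf_run
begin

text \<open>Every foreign reward observed in a block of \<open>j\<close> was still pending when that block, or the
  next phase, began.\<close>

lemma total_le:
  assumes r: "\<And>l a. l \<ge> 1 \<Longrightarrow> a \<in> {1..K} \<Longrightarrow> r l a \<in> {0..1}"
    and j: "j \<in> active m"
  shows "total (Suc m) j \<le> (\<Sum>k<Suc m. \<Sum>l\<in>{rounds k<..rounds (Suc k)}.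
     if phase_arm n (Suc k) (state k) l = j then r l j
     else of_bool (threshold_in n (Suc k) (state k) j l \<le> d l (phase_arm n (Suc k) (state k) l)))"
    (is "_ \<le> (\<Sum>k<Suc m. \<Sum>l\<in>_. ?z k l)")
proof -
  let ?J = "played (Suc m)"
  let ?f = "\<lambda>l. if l + d l (?J l) \<in> idx (Suc m) j then r l (?J l) else 0"
  have "total (Suc m) j = (\<Sum>l\<in>{1..rounds (Suc m)}. ?f l)"
    unfolding total_def by (rule sum_obs_eq) (auto simp: idx_eq)
  also have "\<dots> = (\<Sum>k<Suc m. \<Sum>l\<in>{rounds k<..rounds (Suc k)}. ?f l)"
    by (rule sum_phases)
  also have "\<dots> \<le> (\<Sum>k<Suc m. \<Sum>l\<in>{rounds k<..rounds (Suc k)}. ?z k l)"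
  proof (intro sum_mono)
    fix k l assume k: "k \<in> {..<Suc m}" and l: "l \<in> {rounds k<..rounds (Suc k)}"
    have jk: "j \<in> active k" using j k active_decreasing[of k m] by auto
    have le: "rounds (Suc k) \<le> rounds (Suc m)" using k by (intro rounds_mono) auto
    have J: "?J t = played (Suc k) t" if "t \<le> rounds (Suc k)" for t
      using that k by (intro played_stable) auto
    have arm: "phase_arm n (Suc k) (state k) l = ?J l"
      using l by (simp add: J played_Suc_new)
    have "l \<in> {1..rounds (Suc m)}" using l le by simp
    then have r01: "r l (?J l) \<in> {0..1}" using r played_in by simp
    show "?f l \<le> ?z k l"
    proof (cases "?J l = j")
      case True
      then show ?thesis using r01 arm by auto
    next
      case False
      let ?t = "l + d l (?J l)"
      have "threshold_in n (Suc k) (state k) j l \<le> d l (?J l)" if "?t \<in> idx (Suc m) j"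
      proof (cases "?t \<le> rounds (Suc k)")
        case True
        then have "played (Suc k) ?t = j" using that J[OF True] by (simp add: idx_eq)
        then have t: "bstart k j < ?t" "?t \<le> bstart k j + phase_len n (Suc k)"
          using played_Suc_eq_iff[OF jk, of ?t] l True by auto
        have "\<not> (bstart k j < l \<and> l \<le> bstart k j + phase_len n (Suc k))"
          using False J[of l] played_Suc_eq_iff[OF jk, of l] l by auto
        then have "l \<le> bstart k j" using t by linarith
        then show ?thesis using t by (simp add: threshold_in_def bstart_def)
      next
        case False
        \<comment> \<open>An arrival after the phase lies beyond both the block start and the phase
          end, so the threshold is met on either side of the block.\<close>
        moreover have "bstart k j \<le> rounds (Suc k)" using bend_le[OF jk] by simp
        ultimately show ?thesis by (auto simp: threshold_in_def bstart_def rounds_Suc)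
      qed
      then show ?thesis using False arm r01 by auto
    qed
  qed
  finally show ?thesis .
qed

text \<open>Foreign rewards are nonnegative and are dropped; an own reward that leaves the block
  costs at most 1. The bound is an increment over one phase because the optimal arm that is followed
  may change between phases.\<close>

lemma total_Suc_ge:
  assumes r: "\<And>l a. l \<ge> 1 \<Longrightarrow> a \<in> {1..K} \<Longrightarrow> r l a \<in> {0..1}"
    and j: "j \<in> active m"
  shows "total (Suc m) j \<ge> total m j + (\<Sum>l\<in>{bstart m j<..bstart m j + phase_len n (Suc m)}.
     r l j - of_bool (threshold_out n (Suc m) (state m) j l \<le> d l j))"
proof -
  let ?B = "{bstart m j<..bstart m j + phase_len n (Suc m)}" and ?J = "played (Suc m)"
  have B: "?B \<subseteq> {rounds m<..rounds (Suc m)}"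
    using bstart_ge[of m j] bend_le[OF j] by auto
  have B1: "?B \<subseteq> {1..rounds (Suc m)}"
    using B by (rule order_trans) auto
  have JB: "?J l = j" if "l \<in> ?B" for l
    using that B played_Suc_eq_iff[OF j, of l] by auto
  have "idx m j \<inter> ?B = {}" using bstart_ge[of m j] by (auto simp: idx_eq)
  then have 1: "total (Suc m) j = (\<Sum>t\<in>idx m j. obs r d ?J t) + (\<Sum>t\<in>?B. obs r d ?J t)"
    unfolding total_def idx_Suc_active[OF j] using finite_idx by (simp add: sum.union_disjoint)
  have 2: "(\<Sum>t\<in>idx m j. obs r d ?J t) = total m j"
    unfolding total_def
  proof (intro sum.cong refl obs_cong)
    fix t l assume "t \<in> idx m j" "l \<in> {1..t}"
    then have "l \<le> rounds m" by (auto simp: idx_eq)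
    then show "?J l = played m l" by (intro played_stable) auto
  qed
  have 3: "(\<Sum>t\<in>?B. obs r d ?J t) = (\<Sum>l\<in>{1..rounds (Suc m)}. if l + d l (?J l) \<in> ?B then r l (?J l) else 0)"
    by (rule sum_obs_eq) (rule B1)
  have 4: "(\<Sum>l\<in>?B. if l + d l (?J l) \<in> ?B then r l (?J l) else 0) \<le>
     (\<Sum>l\<in>{1..rounds (Suc m)}. if l + d l (?J l) \<in> ?B then r l (?J l) else 0)"
  proof (rule sum_mono2)
    show "?B \<subseteq> {1..rounds (Suc m)}" by (rule B1)
    show "0 \<le> (if l + d l (?J l) \<in> ?B then r l (?J l) else 0)" if "l \<in> {1..rounds (Suc m)} - ?B" for l
      using r[of l "?J l"] played_in[of l "Suc m"] that by simp
  qed simp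
  have 5: "(\<Sum>l\<in>?B. r l j - of_bool (threshold_out n (Suc m) (state m) j l \<le> d l j)) \<le>
     (\<Sum>l\<in>?B. if l + d l (?J l) \<in> ?B then r l (?J l) else 0)"
  proof (rule sum_mono)
    fix l assume l: "l \<in> ?B"
    have "l \<ge> 1" "j \<in> {1..K}" using l j active_subset[of m] by auto
    then have "r l j \<in> {0..1}" by (rule r)
    then show "r l j - of_bool (threshold_out n (Suc m) (state m) j l \<le> d l j) \<le>
      (if l + d l (?J l) \<in> ?B then r l (?J l) else 0)"
      using l JB[OF l] by (auto simp: threshold_out_def bstart_def)
  qed
  show ?thesis using 1 2 3 4 5 by linarith
qed

end

section \<open>Play counts and the elimination rule\<close>

context odaaf_run
begin

lemma card_idx_active:
  assumes "n 0 = 0" "\<And>k. k \<le> m \<Longrightarrow> n k \<le> n (Suc k)" "j \<in> active m"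
  shows "card (idx (Suc m) j) = n (Suc m)"
  using assms
proof (induction m)
  case 0
  then show ?case by (simp add: card_idx_Suc idx_0 phase_len_def)
next
  case (Suc m)
  have "j \<in> active m" using Suc.prems(3) active_decreasing[of m "Suc m"] by auto
  then have "card (idx (Suc m) j) = n (Suc m)" using Suc by auto
  then show ?case using Suc.prems by (subst card_idx_Suc) (simp add: phase_len_def)
qed

lemma card_idx_le:
  assumes "n 0 = 0" "\<And>k. k < m \<Longrightarrow> n k \<le> n (Suc k)"
  shows "card (idx m j) \<le> n m"
  using assms
proof (induction m)
  case (Suc m)
  have "n m \<le> n (Suc m)" using Suc.prems(2)[of m] by simp
  moreover have "card (idx m j) \<le> n m" using Suc by auto
  ultimately show ?case unfolding card_idx_Suc phase_len_def by (simp split: if_splits) linarith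
qed (simp add: idx_0)

text \<open>All active arms have exactly \<open>n (Suc m)\<close> plays, so averages can be compared
  as totals and the maximum becomes a family of inequalities.\<close>

lemma
  assumes "n 0 = 0" "\<And>k. k \<le> m \<Longrightarrow> n k \<le> n (Suc k)" "n (Suc m) > 0" "j \<in> active m"
  shows active_SucI: "(\<And>i. i \<in> active m \<Longrightarrow>
      total (Suc m) i \<le> total (Suc m) j + real (n (Suc m)) * 2 powr (- real (Suc m))) \<Longrightarrow> j \<in> active (Suc m)"
    and not_active_SucI: "i \<in> active m \<Longrightarrow>
      total (Suc m) j + real (n (Suc m)) * 2 powr (- real (Suc m)) < total (Suc m) i \<Longrightarrow> j \<notin> active (Suc m)"
proof -
  let ?D = "2 powr (- real (Suc m)) :: real"
  let ?X = "\<lambda>j. total (Suc m) j / real (card (idx (Suc m) j))"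
  have X: "?X i = total (Suc m) i / real (n (Suc m))" if "i \<in> active m" for i
    using card_idx_active[OF assms(1,2) that] by simp
  have "j \<in> active (Suc m) \<longleftrightarrow> Max (?X ` active m) \<le> ?X j + ?D"
    unfolding active_Suc using assms(4) by simp
  also have "\<dots> \<longleftrightarrow> (\<forall>i\<in>active m. ?X i \<le> ?X j + ?D)"
    using finite_active active_nonempty by (subst Max_le_iff) auto
  also have "\<dots> \<longleftrightarrow> (\<forall>i\<in>active m. total (Suc m) i \<le> total (Suc m) j + real (n (Suc m)) * ?D)"
  proof (rule ball_cong[OF refl])
    fix i assume i: "i \<in> active m"
    show "?X i \<le> ?X j + ?D \<longleftrightarrow> total (Suc m) i \<le> total (Suc m) j + real (n (Suc m)) * ?D"
      unfolding X[OF i] X[OF assms(4)] using assms(3) by (simp add: field_simps del: of_nat_Suc)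
  qed
  finally have iff: "j \<in> active (Suc m) \<longleftrightarrow>
    (\<forall>i\<in>active m. total (Suc m) i \<le> total (Suc m) j + real (n (Suc m)) * ?D)" .
  show "j \<in> active (Suc m)"
    if "\<And>i. i \<in> active m \<Longrightarrow> total (Suc m) i \<le> total (Suc m) j + real (n (Suc m)) * ?D"
    using that iff by blast
  show "j \<notin> active (Suc m)"
    if "i \<in> active m" "total (Suc m) j + real (n (Suc m)) * ?D < total (Suc m) i"
    using that iff by (meson not_le)
qed

lemma odaaf_arm_eq:
  assumes "t \<le> rounds m"
  shows "odaaf_arm K n r d t = played m t"
proof -
  let ?L = "LEAST m. t \<le> rounds m"
  have L: "t \<le> rounds ?L" "?L \<le> m" using assms by (auto intro: LeastI Least_le)
  have "odaaf_arm K n r d t = played ?L t"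
    using assms unfolding odaaf_arm_def rounds_def played_def state_def by auto
  then show ?thesis using played_stable[OF L(2,1)] by simp
qed

lemma played_active:
  assumes "rounds m < t" "t \<le> rounds m'"
  shows "played m' t \<in> active m"
  using assms
proof (induction m')
  case (Suc m')
  show ?case
  proof (cases "t \<le> rounds m'")
    case True
    then show ?thesis using Suc played_stable[of m' "Suc m'" t] by auto
  next
    case False
    then have "rounds m < rounds (Suc m')" using Suc.prems by linarith
    then have "m \<le> m'" using rounds_mono[of "Suc m'" m] by (metis not_less not_less_eq_eq)
    then show ?thesis using False played_Suc_in[of m' t] Suc.prems active_decreasing[of m m'] by auto
  qed
qed (simp add: rounds_0)

text \<open>An arm that is inactive after \<open>m\<close> phases has had all its plays by then.
  \<open>T <= rounds M\<close> ensures that the phases cover the rounds up to \<open>T\<close>, so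
  \<open>odaaf_arm\<close> does not fall back on its default arm.\<close>

lemma card_arm_le:
  assumes "T \<le> rounds M" "j \<notin> active m"
  shows "card {t \<in> {1..T}. odaaf_arm K n r d t = j} \<le> card (idx m j)"
proof (rule card_mono[OF finite_idx], rule subsetI)
  fix t assume "t \<in> {t \<in> {1..T}. odaaf_arm K n r d t = j}"
  then have t: "1 \<le> t" "t \<le> rounds M" and j: "odaaf_arm K n r d t = j" using assms by auto
  have "t \<le> rounds m"
  proof (rule ccontr)
    assume "\<not> t \<le> rounds m"
    then have "played M t \<in> active m" using played_active t(2) by simp
    then show False using odaaf_arm_eq[OF t(2)] j assms(2) by simp
  qed
  then show "t \<in> idx m j" using t odaaf_arm_eq[of t m] j by (simp add: idx_eq)
qed

lemma odaaf_arm_in: "T \<le> rounds M \<Longrightarrow> t \<in> {1..T} \<Longrightarrow> odaaf_arm K n r d t \<in> {1..K}"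
  using odaaf_arm_eq[of t M] played_in[of t M] by auto

end

section \<open>The phase lengths (N1)\<close>

lemma phase_tolerance: "(2::real) powr (- real m) = 1 / 2 ^ m"
  by (simp add: powr_minus powr_realpow divide_inverse)

lemma odaaf_L_eq:
  assumes "T > 0" shows "odaaf_L T m = ln (real T) - 2 * real m * ln 2"
  using assms by (simp add: odaaf_L_def ln_mult ln_powr power2_eq_square)

lemma exp_odaaf_L:
  assumes "T > 0" shows "exp (- odaaf_L T m) = 4 ^ m / real T"
proof -
  have "exp (- odaaf_L T m) = 1 / (real T * (2 powr (- real m))\<^sup>2)"
    using assms by (simp add: odaaf_L_def exp_minus divide_inverse)
  also have "(2 powr (- real m))\<^sup>2 = 1 / (4::real) ^ m"
    by (simp add: phase_tolerance power2_eq_square power_mult_distrib[symmetric])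
  finally show ?thesis by simp
qed

context
  fixes T :: nat and E :: real and m :: nat and D L :: real
  assumes E: "E \<ge> 0" and m: "m \<ge> 1"
  defines "D \<equiv> 2 powr (- real m)" and "L \<equiv> odaaf_L T m"
begin

private lemma n_eq: "odaaf_n T E m = nat \<lceil>(sqrt (2 * L) + sqrt (2 * L + 8 / 3 * D * L + 6 * D * real m * E))\<^sup>2 / D\<^sup>2\<rceil>"
  using m by (simp add: odaaf_n_def D_def L_def Let_def)

private lemma D_pos: "D > 0" by (simp add: D_def)

text \<open>The squares of the two roots contribute \<open>4 L\<close> and the terms of order
  \<open>D\<close>; the cross term contributes at least another \<open>4 L\<close>, since the second
  root dominates the first.\<close>

lemma odaaf_n_lower:
  assumes L: "L \<ge> 0"
  shows "8 * L + 6 * D * real m * E \<le> real (odaaf_n T E m) * D\<^sup>2"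
proof -
  let ?y = "8 / 3 * D * L + 6 * D * real m * E"
  let ?a = "sqrt (2 * L)" and ?b = "sqrt (2 * L + ?y)"
  have y: "?y \<ge> 0" "6 * D * real m * E \<le> ?y" using L E D_pos by auto
  have a: "?a\<^sup>2 = 2 * L" and b: "?b\<^sup>2 = 2 * L + ?y" using L y by auto
  have "?a \<le> ?b" "0 \<le> ?a" using y L by auto
  then have "?a * ?a \<le> ?a * ?b" by (intro mult_left_mono)
  then have "2 * L \<le> ?a * ?b" using L by simp
  then have "8 * L + ?y \<le> (?a + ?b)\<^sup>2"
    using a b by (simp add: power2_sum)
  moreover have "(?a + ?b)\<^sup>2 / D\<^sup>2 \<le> real (odaaf_n T E m)"
    unfolding n_eq by (simp add: add.assoc[symmetric])
  ultimately show ?thesis using D_pos y(2) by (simp add: pos_divide_le_eq)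
qed

text \<open>From \<open>(a + b)^2 <= 2 a^2 + 2 b^2\<close>. The summand 1 is the cost of rounding
  up; multiplied by the gap it becomes the last summand of the regret bound.\<close>

lemma odaaf_n_upper:
  assumes L: "L \<ge> 0"
  shows "real (odaaf_n T E m) \<le> 1 + (8 * L + 16 / 3 * D * L + 12 * D * real m * E) / D\<^sup>2"
proof -
  let ?y = "8 / 3 * D * L + 6 * D * real m * E"
  let ?a = "sqrt (2 * L)" and ?b = "sqrt (2 * L + ?y)"
  have y: "?y \<ge> 0" using L E D_pos by auto
  have a: "?a\<^sup>2 = 2 * L" and b: "?b\<^sup>2 = 2 * L + ?y" using L y by auto
  have "(?a + ?b)\<^sup>2 \<le> 2 * ?a\<^sup>2 + 2 * ?b\<^sup>2"
    using sum_squares_bound[of ?a ?b] by (simp add: power2_sum)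
  then have "(?a + ?b)\<^sup>2 \<le> 8 * L + 16 / 3 * D * L + 12 * D * real m * E"
    using a b by linarith
  then have "(?a + ?b)\<^sup>2 / D\<^sup>2 \<le> (8 * L + 16 / 3 * D * L + 12 * D * real m * E) / D\<^sup>2"
    by (intro divide_right_mono) auto
  moreover have "real (odaaf_n T E m) \<le> 1 + (?a + ?b)\<^sup>2 / D\<^sup>2"
  proof -
    have "real (nat \<lceil>x\<rceil>) \<le> 1 + x" if "x \<ge> 0" for x :: real
      using that by linarith
    moreover have "(?a + ?b)\<^sup>2 / D\<^sup>2 \<ge> 0" by simp
    ultimately show ?thesis unfolding n_eq by (simp only: add.assoc)
  qed
  ultimately show ?thesis by linarith
qed

end

text \<open>Going back from phase \<open>m + 1\<close> to phase \<open>m\<close> doubles the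
  tolerance and adds \<open>ln 4\<close> to the logarithm, which at most doubles it. Each radicand
  grows by a factor of at most 4, each root by at most 2, and the prefactor \<open>1 / D^2\<close>
  drops by 4.\<close>

lemma odaaf_n_Suc_ge:
  assumes E: "E \<ge> 0" and T: "T > 0" and L: "odaaf_L T (Suc m) \<ge> ln 4"
  shows "odaaf_n T E m \<le> odaaf_n T E (Suc m)"
proof (cases "m = 0")
  case True
  then show ?thesis by (simp add: odaaf_n_def)
next
  case False
  define D L where "D = 2 powr (- real (Suc m))" and "L = odaaf_L T (Suc m)"
  have D2: "2 powr (- real m) = 2 * D" by (simp add: D_def phase_tolerance del: of_nat_Suc)
  have L2: "odaaf_L T m = L + ln 4"
    using ln_realpow[of 2 2] by (simp add: L_def odaaf_L_eq[OF T] algebra_simps)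
  have Dp: "D > 0" by (simp add: D_def)
  have ln4: "ln (4::real) \<ge> 0" by simp
  have L0: "L \<ge> ln 4" using L by (simp add: L_def)
  have Lp: "L \<ge> 0" using L0 ln4 by linarith
  let ?x = "2 * L + 8 / 3 * D * L + 6 * D * real (Suc m) * E"
  let ?x' = "2 * (L + ln 4) + 8 / 3 * (2 * D) * (L + ln 4) + 6 * (2 * D) * real m * E"
  have DL: "D * ln 4 \<le> D * L" using L0 Dp by simp
  have DE: "0 \<le> D * real m * E" "D * real (Suc m) * E \<ge> D * real m * E"
    using E Dp by (auto intro!: mult_right_mono mult_left_mono)
  have x: "?x' \<le> 4 * ?x" using L0 DL DE Lp by (simp add: distrib_left) (simp add: algebra_simps)
  have s1: "sqrt (2 * (L + ln 4)) \<le> 2 * sqrt (2 * L)"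
  proof -
    have "sqrt (2 * (L + ln 4)) \<le> sqrt (4 * (2 * L))" using L0 Lp by simp
    also have "\<dots> = 2 * sqrt (2 * L)" by (simp only: real_sqrt_mult real_sqrt_four)
    finally show ?thesis .
  qed
  have s2: "sqrt ?x' \<le> 2 * sqrt ?x"
  proof -
    have "sqrt ?x' \<le> sqrt (4 * ?x)" using x by simp
    also have "\<dots> = 2 * sqrt ?x" by (simp only: real_sqrt_mult real_sqrt_four)
    finally show ?thesis .
  qed
  have x'0: "?x' \<ge> 0" using Lp ln4 Dp E by simp
  have "(sqrt (2 * (L + ln 4)) + sqrt ?x')\<^sup>2 \<le> (2 * sqrt (2 * L) + 2 * sqrt ?x)\<^sup>2"
    using s1 s2 x'0 Lp ln4 by (intro power_mono add_mono) auto
  also have "\<dots> = 4 * (sqrt (2 * L) + sqrt ?x)\<^sup>2"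
    by (simp add: power2_eq_square algebra_simps)
  finally have "(1 / (2 * D)\<^sup>2) * (sqrt (2 * (L + ln 4)) + sqrt ?x')\<^sup>2 \<le>
     (1 / (2 * D)\<^sup>2) * (4 * (sqrt (2 * L) + sqrt ?x)\<^sup>2)"
    by (intro mult_left_mono) auto
  also have "\<dots> = (1 / D\<^sup>2) * (sqrt (2 * L) + sqrt ?x)\<^sup>2"
    by (simp add: power2_eq_square)
  finally have "nat \<lceil>(1 / (2 * D)\<^sup>2) * (sqrt (2 * (L + ln 4)) + sqrt ?x')\<^sup>2\<rceil> \<le>
     nat \<lceil>(1 / D\<^sup>2) * (sqrt (2 * L) + sqrt ?x)\<^sup>2\<rceil>"
    by (intro nat_mono ceiling_mono)
  then show ?thesis
    unfolding odaaf_n_def Let_def D2 L2 D_def[symmetric] L_def[symmetric]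
    using False by (simp only: nat.distinct if_False)
qed

text \<open>Once \<open>L\<^sub>m\<close> is very negative, both square roots of (N1) are taken of negative numbers; Isabelle's
  odd extension of \<open>sqrt\<close> still makes their squared sum grow like \<open>4\<^sup>m\<close>.\<close>

lemma odaaf_n_unbounded:
  assumes E: "E \<ge> 0" and T: "T > 0"
  shows "\<exists>m. N \<le> odaaf_n T E m"
proof -
  \<comment> \<open>The witness makes \<open>L <= - 2 E - N\<close>. This outweighs the delay term,
    at most \<open>3 E\<close>, so both radicands are nonpositive and both roots have the same sign;
    the square is then at least \<open>- 2 L >= N\<close>.\<close>
  obtain m0 :: nat where m0: "(ln (real T) + 2 * E + real N) / (2 * ln 2) \<le> real m0"
    using real_arch_simple by blast
  define m where "m = Suc m0"
  define D L where "D = 2 powr (- real m)" and "L = odaaf_L T m"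
  have "ln (real T) + 2 * E + real N \<le> 2 * real m * ln 2"
  proof -
    have "ln (real T) + 2 * E + real N \<le> real m0 * (2 * ln 2)"
      using m0 by (simp add: pos_divide_le_eq)
    also have "\<dots> \<le> real m * (2 * ln 2)" by (intro mult_right_mono) (auto simp: m_def)
    finally show ?thesis by (simp add: mult_ac)
  qed
  then have L: "L \<le> - 2 * E - real N" by (simp add: L_def odaaf_L_eq[OF T])
  then have L0: "L \<le> 0" using E by linarith
  have D: "0 < D" "D \<le> 1" by (auto simp: D_def phase_tolerance)
  have Dm: "D * real m \<le> 1 / 2 * 1"
  proof -
    have "2 * m \<le> 2 ^ m"
      unfolding m_def using self_le_ge2_pow[of 2 "m0"] by (induction m0) auto
    then have "2 * real m \<le> 2 ^ m" by (metis of_nat_le_iff of_nat_mult of_nat_numeral of_nat_power)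
    then show ?thesis by (simp add: D_def phase_tolerance field_simps)
  qed
  have "6 * D * real m * E \<le> 3 * E"
    using mult_right_mono[OF Dm E] by (simp add: mult_ac)
  moreover have "8 / 3 * D * L \<le> 0" using D L0 by (simp add: mult_nonneg_nonpos)
  ultimately have "2 * L + 8 / 3 * D * L + 6 * D * real m * E \<le> 0" using L E by linarith
  then have "sqrt (2 * L + 8 / 3 * D * L + 6 * D * real m * E) \<le> 0" by simp
  then have "sqrt (2 * L) + sqrt (2 * L + 8 / 3 * D * L + 6 * D * real m * E) \<le> sqrt (2 * L)" by simp
  moreover have "sqrt (2 * L) \<le> 0" using L0 by simp
  ultimately have "(sqrt (2 * L))\<^sup>2 \<le> (sqrt (2 * L) + sqrt (2 * L + 8 / 3 * D * L + 6 * D * real m * E))\<^sup>2"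
    unfolding abs_le_square_iff[symmetric] by linarith
  moreover have "(sqrt (2 * L))\<^sup>2 = - 2 * L"
  proof -
    have "(sqrt (2 * L))\<^sup>2 = (sqrt (- (2 * L)))\<^sup>2" unfolding real_sqrt_minus by simp
    then show ?thesis using L0 by simp
  qed
  ultimately have "real N \<le> (sqrt (2 * L) + sqrt (2 * L + 8 / 3 * D * L + 6 * D * real m * E))\<^sup>2"
    using L E L0 by linarith
  also have "\<dots> \<le> (1 / D\<^sup>2) * \<dots>"
    using mult_right_mono[of 1 "1 / D\<^sup>2" "\<dots>"] D by (simp add: power_le_one)
  finally have "real N \<le> (1 / D\<^sup>2) * (sqrt (2 * L) + sqrt (2 * L + 8 / 3 * D * L + 6 * D * real m * E))\<^sup>2" .
  then have "N \<le> nat \<lceil>(1 / D\<^sup>2) * (sqrt (2 * L) + sqrt (2 * L + 8 / 3 * D * L + 6 * D * real m * E))\<^sup>2\<rceil>"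
    by linarith
  then have "N \<le> odaaf_n T E m"
    unfolding odaaf_n_def Let_def D_def[symmetric] L_def[symmetric] by (simp add: m_def)
  then show ?thesis by blast
qed

section \<open>Concentration of the observed sums\<close>

context odaaf_run
begin

lemma phase_arm_block:
  assumes "j \<in> active m"
  shows "{l \<in> {rounds m<..rounds (Suc m)}. phase_arm n (Suc m) (state m) l = j} =
    {bstart m j<..bstart m j + phase_len n (Suc m)}"
  using played_Suc_eq_iff[OF assms] played_Suc_new[of m] bstart_ge[of m j] bend_le[OF assms] by fastforce

lemma sum_block:
  fixes f :: "nat \<Rightarrow> real"
  assumes "j \<in> active m"
  shows "(\<Sum>l\<in>{rounds m<..rounds (Suc m)}. if phase_arm n (Suc m) (state m) l = j then f l else 0) =
    (\<Sum>l\<in>{bstart m j<..bstart m j + phase_len n (Suc m)}. f l)"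
  unfolding phase_arm_block[OF assms, symmetric] by (rule sum.inter_filter[symmetric]) simp

text \<open>Within a phase the thresholds are pairwise distinct on each side of the block of \<open>j\<close>.\<close>

lemma sum_threshold_in:
  fixes f :: "nat \<Rightarrow> real"
  assumes j: "j \<in> active m"
    and f: "\<And>C. finite C \<Longrightarrow> 0 \<notin> C \<Longrightarrow> (\<Sum>c\<in>C. f c) \<le> E"
  shows "(\<Sum>l\<in>{rounds m<..rounds (Suc m)}. if phase_arm n (Suc m) (state m) l = j then 0
     else f (threshold_in n (Suc m) (state m) j l)) \<le> 2 * E"
proof -
  let ?b = "bstart m j" and ?e = "rounds (Suc m)" and ?len = "phase_len n (Suc m)"
  let ?g = "\<lambda>l. if phase_arm n (Suc m) (state m) l = j then 0 else f (threshold_in n (Suc m) (state m) j l)"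
  have reflect: "(\<Sum>l\<in>{x<..y}. f (z + 1 - l)) \<le> E" if "y \<le> z" for x y z
  proof -
    have "(\<Sum>l\<in>{x<..y}. f (z + 1 - l)) = (\<Sum>c\<in>(\<lambda>l. z + 1 - l) ` {x<..y}. f c)"
      using that by (subst sum.reindex) (auto simp: inj_on_def)
    also have "\<dots> \<le> E" using that by (intro f) auto
    finally show ?thesis .
  qed
  have split: "{rounds m<..?e} = {rounds m<..?b} \<union> {?b<..?b + ?len} \<union> {?b + ?len<..?e}"
    using bstart_ge[of m j] bend_le[OF j] by auto
  have arm: "phase_arm n (Suc m) (state m) l = j \<longleftrightarrow> l \<in> {?b<..?b + ?len}" if "l \<in> {rounds m<..?e}" for l
    using phase_arm_block[OF j] that by blast
  have left: "?g l = f (?b + 1 - l)" if "l \<in> {rounds m<..?b}" for l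
    using arm[of l] that bend_le[OF j] by (auto simp: threshold_in_def bstart_def)
  have right: "?g l = f (?e + 1 - l)" if "l \<in> {?b + ?len<..?e}" for l
    using arm[of l] that bstart_ge[of m j] by (auto simp: threshold_in_def bstart_def rounds_Suc)
  have "(\<Sum>l\<in>{rounds m<..?e}. ?g l) =
     (\<Sum>l\<in>{rounds m<..?b}. ?g l) + (\<Sum>l\<in>{?b<..?b + ?len}. ?g l) + (\<Sum>l\<in>{?b + ?len<..?e}. ?g l)"
    unfolding split by (subst sum.union_disjoint; (subst sum.union_disjoint)?; auto)
  also have "(\<Sum>l\<in>{rounds m<..?b}. ?g l) = (\<Sum>l\<in>{rounds m<..?b}. f (?b + 1 - l))"
    using left by (intro sum.cong) auto
  also have "(\<Sum>l\<in>{?b<..?b + ?len}. ?g l) = 0"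
    using arm split by (intro sum.neutral) auto
  also have "(\<Sum>l\<in>{?b + ?len<..?e}. ?g l) = (\<Sum>l\<in>{?b + ?len<..?e}. f (?e + 1 - l))"
    using right by (intro sum.cong) auto
  finally show ?thesis
    using reflect[of ?b ?b "rounds m"] reflect[of ?e ?e "?b + ?len"] by simp
qed

text \<open>The own block has a single exit, so a phase costs one mean delay here, against two for
  foreign plays.\<close>

lemma sum_threshold_out:
  fixes f :: "nat \<Rightarrow> real"
  assumes f: "\<And>C. finite C \<Longrightarrow> 0 \<notin> C \<Longrightarrow> (\<Sum>c\<in>C. f c) \<le> E"
  shows "(\<Sum>l\<in>{bstart m j<..bstart m j + phase_len n (Suc m)}. f (threshold_out n (Suc m) (state m) j l)) \<le> E"
proof -
  let ?z = "bstart m j + phase_len n (Suc m)"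
  have "(\<Sum>l\<in>{bstart m j<..?z}. f (threshold_out n (Suc m) (state m) j l)) = (\<Sum>l\<in>{bstart m j<..?z}. f (?z + 1 - l))"
    by (simp add: threshold_out_def bstart_def)
  also have "\<dots> = (\<Sum>c\<in>(\<lambda>l. ?z + 1 - l) ` {bstart m j<..?z}. f c)"
    by (subst sum.reindex) (auto simp: inj_on_def)
  also have "\<dots> \<le> E" by (intro f) auto
  finally show ?thesis .
qed

end

section \<open>Markov's inequality and exponential moments\<close>

lemma (in prob_space) prob_le_exp_of_weight:
  assumes W: "W \<in> borel_measurable M" "(\<integral>\<^sup>+\<omega>. W \<omega> \<partial>M) \<le> 1" and A: "A \<in> sets M"
    and le: "AE \<omega> in M. \<omega> \<in> A \<longrightarrow> ennreal (exp x) \<le> W \<omega>"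
  shows "prob A \<le> exp (- x)"
proof -
  have "ennreal (exp x) * emeasure M A = (\<integral>\<^sup>+\<omega>. ennreal (exp x) * indicator A \<omega> \<partial>M)"
    using A by (simp add: nn_integral_cmult_indicator)
  also have "\<dots> \<le> (\<integral>\<^sup>+\<omega>. W \<omega> \<partial>M)"
    using le by (intro nn_integral_mono_AE) (auto simp: indicator_def elim!: eventually_mono)
  also have "\<dots> \<le> 1" by fact
  finally have "ennreal (exp x * prob A) \<le> ennreal 1"
    by (simp add: emeasure_eq_measure ennreal_mult)
  then have "exp x * prob A \<le> 1" by (simp add: ennreal_le_iff)
  then show ?thesis by (simp add: exp_minus field_simps)
qed

text \<open>With \<open>p\<close> the probability of the event, the moment generating function of
  its indicator is \<open>1 + (exp u - 1) p\<close>, at most \<open>exp ((exp u - 1) p)\<close>. The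
  cost of delays is thus linear in their tail probabilities, so only the mean delay enters and no
  higher moment.\<close>

lemma (in prob_space) nn_integral_exp_event:
  assumes "A \<in> sets M"
  shows "(\<integral>\<^sup>+\<omega>. ennreal (exp (u * indicator A \<omega> - (exp u - 1) * prob A)) \<partial>M) \<le> 1"
proof -
  let ?c = "exp (- ((exp u - 1) * prob A))"
  have int: "integrable M (indicator A :: _ \<Rightarrow> real)"
    using assms by (intro integrable_real_indicator) (auto simp: emeasure_eq_measure)
  have eq: "exp (u * indicator A \<omega> - (exp u - 1) * prob A) = ?c * (1 + (exp u - 1) * indicator A \<omega>)" for \<omega>
    by (auto simp: indicator_def exp_add[symmetric])
  have "(\<integral>\<^sup>+\<omega>. ennreal (exp (u * indicator A \<omega> - (exp u - 1) * prob A)) \<partial>M)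
    = ennreal (\<integral>\<omega>. ?c * (1 + (exp u - 1) * indicator A \<omega>) \<partial>M)"
    unfolding eq
  proof (rule nn_integral_eq_integral)
    show "integrable M (\<lambda>\<omega>. ?c * (1 + (exp u - 1) * indicator A \<omega>))" using int by simp
    show "AE \<omega> in M. 0 \<le> ?c * (1 + (exp u - 1) * indicator A \<omega>)"
      by (rule AE_I2) (simp add: eq[symmetric])
  qed
  also have "(\<integral>\<omega>. ?c * (1 + (exp u - 1) * indicator A \<omega>) \<partial>M) = ?c * (1 + (exp u - 1) * prob A)"
    using int assms by (simp add: prob_space)
  also have "\<dots> \<le> ennreal 1"
  proof (rule ennreal_leI)
    have "?c * (1 + (exp u - 1) * prob A) \<le> ?c * exp ((exp u - 1) * prob A)"
      by (intro mult_left_mono exp_ge_add_one_self) auto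
    also have "\<dots> = 1" by (simp add: exp_add[symmetric])
    finally show "?c * (1 + (exp u - 1) * prob A) \<le> 1" .
  qed
  finally show ?thesis by simp
qed

section \<open>The random run as a phased play\<close>

lemma measurable_selection:
  fixes S :: "nat \<Rightarrow> 'b \<Rightarrow> real"
  assumes [measurable]: "\<And>j. S j \<in> borel_measurable F" and fin: "finite A" "finite C"
  shows "{\<omega> \<in> space F. (\<forall>j. (j \<in> A \<and> (\<forall>i\<in>A. S i \<omega> / c i \<le> S j \<omega> / c j + e)) = (j \<in> B)) \<and> P \<and>
     (LEAST j. j \<in> C \<and> (\<forall>i\<in>C. S i \<omega> \<le> S j \<omega>)) = a} \<in> sets F"
  using fin by measurable

text \<open>The delay law is represented by its tail function; \<open>tail_sum\<close> is the finite
  form of the identity between the mean and the sum of the tails. The phase lengths \<open>n\<close>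
  and the set \<open>best\<close> are still arbitrary.\<close>

locale odaaf_bandit = delayed_feedback +
  fixes n :: "nat \<Rightarrow> nat" and \<mu> :: "nat \<Rightarrow> real" and tail :: "nat \<Rightarrow> real" and Etau :: real and best :: "nat set"
  assumes K_ge_1: "K \<ge> 1"
    and AE_R: "\<And>l j. l \<ge> 1 \<Longrightarrow> j \<in> {1..K} \<Longrightarrow> AE \<omega> in M. R l j \<omega> \<in> {0..1}"
    and mean_R: "\<And>l j. l \<ge> 1 \<Longrightarrow> j \<in> {1..K} \<Longrightarrow> expectation (R l j) = \<mu> j"
    and tail: "\<And>l j c. l \<ge> 1 \<Longrightarrow> j \<in> {1..K} \<Longrightarrow> prob {\<omega> \<in> space M. c \<le> D l j \<omega>} = tail c"
    and tail_sum: "\<And>C. finite C \<Longrightarrow> 0 \<notin> C \<Longrightarrow> (\<Sum>c\<in>C. tail c) \<le> Etau"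
begin

abbreviation rew where "rew \<omega> \<equiv> (\<lambda>l j. R l j \<omega>)"
abbreviation del where "del \<omega> \<equiv> (\<lambda>l j. D l j \<omega>)"

lemma run: "odaaf_run K"
  by unfold_locales (rule K_ge_1)

abbreviation st where "st k \<omega> \<equiv> odaaf_run.state K n (rew \<omega>) (del \<omega>) k"
abbreviation act where "act k \<omega> \<equiv> odaaf_run.active K n (rew \<omega>) (del \<omega>) k"
abbreviation rnd where "rnd k \<omega> \<equiv> odaaf_run.rounds K n (rew \<omega>) (del \<omega>) k"
abbreviation tot where "tot k \<omega> \<equiv> odaaf_run.total K n (rew \<omega>) (del \<omega>) k"
abbreviation bst where "bst k \<omega> \<equiv> odaaf_run.bstart K n (rew \<omega>) (del \<omega>) k"

text \<open>The leader of a phase is the arm of \<open>best\<close> that scored highest in the previous phase.  It is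
  known when the phase starts, so its fresh rewards are unbiased; following the leaders bounds the
  best optimal score without a union bound over the optimal arms.\<close>

definition step :: "nat \<Rightarrow> odaaf_state \<times> nat \<Rightarrow> 'a \<Rightarrow> odaaf_state \<times> nat" where
  "step k x \<omega> = (odaaf_phase n (rew \<omega>) (del \<omega>) (Suc k) (fst x),
     LEAST j. j \<in> best \<inter> fst (fst x) \<and> (\<forall>i\<in>best \<inter> fst (fst x).
        phase_sum n (rew \<omega>) (del \<omega>) (Suc k) (fst x) i \<le> phase_sum n (rew \<omega>) (del \<omega>) (Suc k) (fst x) j))"

primrec q :: "nat \<Rightarrow> 'a \<Rightarrow> odaaf_state \<times> nat" where
  "q 0 \<omega> = (odaaf_states K n (rew \<omega>) (del \<omega>) 0, LEAST j. j \<in> best)"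
| "q (Suc k) \<omega> = step k (q k \<omega>) \<omega>"

definition lead :: "nat \<Rightarrow> 'a \<Rightarrow> nat" where "lead k \<omega> = snd (q k \<omega>)"

definition pos :: "odaaf_state \<times> nat \<Rightarrow> nat" where "pos x = fst (snd (fst x))"
definition len :: "nat \<Rightarrow> odaaf_state \<times> nat \<Rightarrow> nat" where
  "len k x = card (fst (fst x)) * phase_len n (Suc k)"
definition arm :: "odaaf_state \<times> nat \<Rightarrow> nat \<Rightarrow> nat \<Rightarrow> nat" where "arm x k l = phase_arm n (Suc k) (fst x) l"

lemma fst_q: "fst (q k \<omega>) = st k \<omega>"
  by (induction k) (simp_all add: odaaf_run.state_def[OF run] step_def)

lemma pos_len: "pos x + len k x = phase_end n (Suc k) (fst x)"
  by (simp add: pos_def len_def phase_end_def)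

lemma pos_q: "pos (q k \<omega>) = rnd k \<omega>"
  by (simp add: pos_def fst_q odaaf_run.rounds_def[OF run])

lemma pos_len_q: "pos (q k \<omega>) + len k (q k \<omega>) = rnd (Suc k) \<omega>"
  by (simp add: pos_len fst_q odaaf_run.rounds_Suc[OF run])

lemma lead_Suc: "lead (Suc k) \<omega> = (LEAST j. j \<in> best \<inter> act k \<omega> \<and>
    (\<forall>i\<in>best \<inter> act k \<omega>. tot (Suc k) \<omega> i \<le> tot (Suc k) \<omega> j))"
  by (simp add: lead_def step_def fst_q odaaf_run.total_Suc[OF run] odaaf_run.active_def[OF run])

lemma measurable_obs:
  assumes "\<And>l. l \<in> {1..t} \<Longrightarrow> J l \<in> {1..K}" "t \<le> s"
  shows "(\<lambda>\<omega>. obs (rew \<omega>) (del \<omega>) J t) \<in> borel_measurable (hist s)"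
  unfolding obs_def
proof (rule borel_measurable_sum)
  fix l assume l: "l \<in> {1..t}"
  have [measurable]: "R l (J l) \<in> borel_measurable (hist s)" "D l (J l) \<in> measurable (hist s) (count_space UNIV)"
    unfolding hist_def using assms l by (auto intro!: R_gen D_gen)
  show "(\<lambda>\<omega>. if l + D l (J l) \<omega> = t then R l (J l) \<omega> else 0) \<in> borel_measurable (hist s)"
    by measurable
qed

lemma measurable_phase_sum:
  fixes \<omega> :: 'a
  shows "(\<lambda>\<omega>'. phase_sum n (rew \<omega>') (del \<omega>') (Suc k) (st k \<omega>) j) \<in> borel_measurable (hist (rnd (Suc k) \<omega>))"
  unfolding phase_sum_def
proof (rule borel_measurable_sum)
  fix t assume "t \<in> phase_idx n (Suc k) (st k \<omega>) j"
  then have t: "t \<le> rnd (Suc k) \<omega>"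
    by (auto simp: odaaf_run.idx_Suc[OF run, symmetric] odaaf_run.idx_eq[OF run])
  show "(\<lambda>\<omega>'. obs (rew \<omega>') (del \<omega>') (phase_play n (Suc k) (st k \<omega>)) t) \<in> borel_measurable (hist (rnd (Suc k) \<omega>))"
    using odaaf_run.played_in[OF run, where r = "rew \<omega>" and d = "del \<omega>" and m = "Suc k"] t
    by (intro measurable_obs) (auto simp: odaaf_run.played_Suc[OF run])
qed

lemma measurable_step:
  fixes \<omega> :: 'a
  shows "{\<omega>' \<in> space M. step k (q k \<omega>) \<omega>' = y} \<in> sets (hist (rnd (Suc k) \<omega>))"
proof -
  let ?st = "st k \<omega>" and ?F = "hist (rnd (Suc k) \<omega>)" and ?A = "act k \<omega>"
  define S where "S = (\<lambda>j \<omega>'. phase_sum n (rew \<omega>') (del \<omega>') (Suc k) ?st j)"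
  let ?c = "\<lambda>j. real (card (phase_idx n (Suc k) ?st j))"
  have S: "S j \<in> borel_measurable ?F" for j unfolding S_def by (rule measurable_phase_sum)
  have fin: "finite ?A" "?A \<noteq> {}" using odaaf_run.finite_active[OF run] odaaf_run.active_nonempty[OF run] by auto
  have A: "fst ?st = ?A" by (simp add: odaaf_run.active_def[OF run])
  let ?in = "\<lambda>j \<omega>'. j \<in> ?A \<and> (\<forall>i\<in>?A. S i \<omega>' / ?c i \<le> S j \<omega>' / ?c j + 2 powr (- real (Suc k)))"
  let ?L = "\<lambda>\<omega>'. LEAST j. j \<in> best \<inter> ?A \<and> (\<forall>i\<in>best \<inter> ?A. S i \<omega>' \<le> S j \<omega>')"
  have in_eq: "j \<in> {j \<in> ?A. Max ((\<lambda>j. S j \<omega>' / ?c j) ` ?A) \<le> S j \<omega>' / ?c j + 2 powr (- real (Suc k))} \<longleftrightarrow> ?in j \<omega>'"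
    for j \<omega>' using fin by (auto simp: Max_le_iff)
  \<comment> \<open>Reaching a given next state amounts to comparisons of phase sums; the remaining
    components do not depend on the outcome and form a constant condition.\<close>
  have step_eq: "step k (q k \<omega>) \<omega>' = y \<longleftrightarrow> (\<forall>j. (?in j \<omega>') = (j \<in> fst (fst y))) \<and>
      (phase_end n (Suc k) ?st, phase_play n (Suc k) ?st, phase_idx n (Suc k) ?st) = snd (fst y) \<and> ?L \<omega>' = snd y" for \<omega>'
  proof -
    have 1: "fst (fst (step k (q k \<omega>) \<omega>')) = fst (fst y) \<longleftrightarrow> (\<forall>j. (?in j \<omega>') = (j \<in> fst (fst y)))"
      unfolding step_def odaaf_phase_eq fst_q A fst_conv set_eq_iff in_eq[unfolded S_def] S_def by (rule refl)
    have 2: "snd (fst (step k (q k \<omega>) \<omega>')) =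
        (phase_end n (Suc k) ?st, phase_play n (Suc k) ?st, phase_idx n (Suc k) ?st)"
      unfolding step_def odaaf_phase_eq fst_q fst_conv snd_conv by (rule refl)
    have 3: "snd (step k (q k \<omega>) \<omega>') = ?L \<omega>'"
      unfolding step_def fst_q A snd_conv S_def by (rule refl)
    have 4: "u = y \<longleftrightarrow> fst (fst u) = fst (fst y) \<and> snd (fst u) = snd (fst y) \<and> snd u = snd y" for u
      by (auto simp: prod_eq_iff)
    show ?thesis unfolding 4 1 2 3 by (rule refl)
  qed
  have "{\<omega>' \<in> space ?F. step k (q k \<omega>) \<omega>' = y} \<in> sets ?F"
    unfolding step_eq by (rule measurable_selection) (use fin S in auto)
  then show ?thesis by (simp add: hist_def)
qed

sublocale phased_play M K R D q len pos arm step
proof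
  show "\<exists>x. \<forall>\<omega>\<in>space M. q 0 \<omega> = x" by auto
  show "q (Suc k) \<omega> = step k (q k \<omega>) \<omega>" for k \<omega> by simp
  show "pos (step k x \<omega>) = pos x + len k x" for k x \<omega>
    by (simp add: pos_len) (simp add: pos_def step_def odaaf_phase_eq)
  show "finite (step k (q k \<omega>) ` space M)" for k \<omega>
  proof (rule finite_subset)
    \<comment> \<open>If no arm of \<open>best\<close> is active, \<open>LEAST\<close> returns a
      fixed default value; adding this value to the range keeps it finite.\<close>
    let ?st = "st k \<omega>" and ?A = "act k \<omega>"
    let ?B = "(Pow ?A \<times> {(phase_end n (Suc k) ?st, phase_play n (Suc k) ?st, phase_idx n (Suc k) ?st)})
       \<times> insert (LEAST j. False) ?A"
    show "finite ?B" using odaaf_run.finite_active[OF run] by simp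
    show "step k (q k \<omega>) ` space M \<subseteq> ?B"
    proof (rule image_subsetI)
      fix \<omega>'
      have L: "(LEAST j. P j) \<in> insert (LEAST j. False) ?A" if "\<And>j. P j \<Longrightarrow> j \<in> ?A" for P
      proof (cases "\<exists>j. P j")
        case True
        then show ?thesis using LeastI_ex[OF True] that by blast
      next
        case False
        then have "P = (\<lambda>_. False)" by auto
        then show ?thesis by simp
      qed
      have "snd (step k (q k \<omega>) \<omega>') \<in> insert (LEAST j. False) ?A"
        unfolding step_def snd_conv by (rule L) (simp add: fst_q odaaf_run.active_def[OF run])
      moreover have "fst (step k (q k \<omega>) \<omega>') \<in>
          Pow ?A \<times> {(phase_end n (Suc k) ?st, phase_play n (Suc k) ?st, phase_idx n (Suc k) ?st)}"
        unfolding step_def odaaf_phase_eq fst_q fst_conv odaaf_run.active_def[OF run] by blast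
      ultimately show "step k (q k \<omega>) \<omega>' \<in> ?B" by (metis mem_Times_iff)
    qed
  qed
  show "{\<omega>' \<in> space M. step k (q k \<omega>) \<omega>' = y} \<in> sets (hist (pos (q k \<omega>) + len k (q k \<omega>)))" for k \<omega> y
    unfolding pos_len_q by (rule measurable_step)
  show "arm (q k \<omega>) k l \<in> {1..K}" if "pos (q k \<omega>) < l" "l \<le> pos (q k \<omega>) + len k (q k \<omega>)" for k \<omega> l
  proof -
    have l: "rnd k \<omega> < l" "l \<le> rnd (Suc k) \<omega>"
      using that(1) that(2)[unfolded pos_len_q] by (simp_all only: pos_q)
    then have "arm (q k \<omega>) k l = odaaf_run.played K n (rew \<omega>) (del \<omega>) (Suc k) l"
      unfolding arm_def fst_q by (rule odaaf_run.played_Suc_new[OF run, symmetric])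
    then show ?thesis using odaaf_run.played_in[OF run] l by simp
  qed
qed

lemma weight_exp:
  "weight (\<lambda>k x l r d. ennreal (exp (h k x l r d))) m \<omega> =
    ennreal (exp (\<Sum>k<m. \<Sum>l\<in>{rnd k \<omega><..rnd (Suc k) \<omega>}.
       h k (q k \<omega>) l (R l (phase_arm n (Suc k) (st k \<omega>) l) \<omega>) (D l (phase_arm n (Suc k) (st k \<omega>) l) \<omega>)))"
proof (induction m)
  case (Suc m)
  show ?case
    unfolding weight.simps Suc pos_len_q unfolding pos_q arm_def fst_q
    by (simp add: prod_ennreal exp_sum[symmetric] ennreal_mult[symmetric] exp_add)
qed simp

end

section \<open>Tail bounds for the observed sums, survival and elimination\<close>

context odaaf_bandit
begin

lemma nn_integral_hoeffding:
  assumes f: "f \<in> borel_measurable M" "AE \<omega> in M. f \<omega> \<in> {a..a + 1}" and u: "u > 0"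
  shows "(\<integral>\<^sup>+\<omega>. ennreal (exp (u * (f \<omega> - expectation f) - u\<^sup>2 / 8)) \<partial>M) \<le> 1"
proof -
  interpret f: interval_bounded_random_variable M f a "a + 1"
    by unfold_locales (use f in auto)
  have "(\<integral>\<^sup>+\<omega>. ennreal (exp (u * (f \<omega> - expectation f) - u\<^sup>2 / 8)) \<partial>M)
    = (\<integral>\<^sup>+\<omega>. ennreal (exp (u * (f \<omega> - expectation f))) * ennreal (exp (- (u\<^sup>2 / 8))) \<partial>M)"
    by (simp add: ennreal_mult[symmetric] exp_add[symmetric])
  also have "\<dots> = (\<integral>\<^sup>+\<omega>. ennreal (exp (u * (f \<omega> - expectation f))) \<partial>M) * ennreal (exp (- (u\<^sup>2 / 8)))"
    using f(1) by (intro nn_integral_multc) measurable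
  also have "\<dots> \<le> ennreal (exp (u\<^sup>2 * (a + 1 - a)\<^sup>2 / 8)) * ennreal (exp (- (u\<^sup>2 / 8)))"
    by (intro mult_right_mono f.Hoeffdings_lemma_nn_integral u) auto
  also have "\<dots> = 1" by (simp add: ennreal_mult[symmetric] exp_add[symmetric])
  finally show ?thesis .
qed

lemma nn_integral_reward_upper:
  assumes "l \<ge> 1" "j \<in> {1..K}" "u > 0"
  shows "(\<integral>\<^sup>+\<omega>. ennreal (exp (u * (R l j \<omega> - \<mu> j) - u\<^sup>2 / 8)) \<partial>M) \<le> 1"
  using nn_integral_hoeffding[of "R l j" 0 u] AE_R[OF assms(1,2)] mean_R[OF assms(1,2)] assms(3) by simp

lemma nn_integral_reward_lower:
  assumes "l \<ge> 1" "j \<in> {1..K}" "u > 0"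
  shows "(\<integral>\<^sup>+\<omega>. ennreal (exp (u * (\<mu> j - R l j \<omega>) - u\<^sup>2 / 8)) \<partial>M) \<le> 1"
  using nn_integral_hoeffding[of "\<lambda>\<omega>. - R l j \<omega>" "-1" u] AE_R[OF assms(1,2)] mean_R[OF assms(1,2)] assms(3)
  by simp

lemma nn_integral_delay:
  assumes "l \<ge> 1" "j \<in> {1..K}"
  shows "(\<integral>\<^sup>+\<omega>. ennreal (exp (u * of_bool (c \<le> D l j \<omega>) - (exp u - 1) * tail c)) \<partial>M) \<le> 1"
proof -
  let ?A = "{\<omega> \<in> space M. c \<le> D l j \<omega>}"
  have "(\<integral>\<^sup>+\<omega>. ennreal (exp (u * of_bool (c \<le> D l j \<omega>) - (exp u - 1) * tail c)) \<partial>M) =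
    (\<integral>\<^sup>+\<omega>. ennreal (exp (u * indicator ?A \<omega> - (exp u - 1) * prob ?A)) \<partial>M)"
    using tail[OF assms] by (intro nn_integral_cong) (auto simp: indicator_def)
  also have "\<dots> \<le> 1" by (rule nn_integral_exp_event) measurable
  finally show ?thesis .
qed

text \<open>Reward and delay of one play are separate coordinates, hence independent, so a single
  factor can carry both deviations.\<close>

lemma nn_integral_reward_delay:
  assumes "l \<ge> 1" "j \<in> {1..K}" "u > 0"
  shows "(\<integral>\<^sup>+\<omega>. ennreal (exp (u * (\<mu> j - R l j \<omega> + of_bool (c \<le> D l j \<omega>)) - u\<^sup>2 / 8 - (exp u - 1) * tail c)) \<partial>M) \<le> 1"
proof -
  let ?f = "\<lambda>\<omega>. ennreal (exp (u * (\<mu> j - R l j \<omega>) - u\<^sup>2 / 8))"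
  let ?g = "\<lambda>\<omega>. ennreal (exp (u * of_bool (c \<le> D l j \<omega>) - (exp u - 1) * tail c))"
  have [measurable]: "R l j \<in> borel_measurable (gen {(True, l, j)})"
      "D l j \<in> measurable (gen {(False, l, j)}) (count_space UNIV)"
    by (auto intro: R_gen D_gen)
  have "(\<integral>\<^sup>+\<omega>. ennreal (exp (u * (\<mu> j - R l j \<omega> + of_bool (c \<le> D l j \<omega>)) - u\<^sup>2 / 8 - (exp u - 1) * tail c)) \<partial>M)
    = (\<integral>\<^sup>+\<omega>. ?f \<omega> * ?g \<omega> \<partial>M)"
    by (intro nn_integral_cong) (simp add: ennreal_mult[symmetric] exp_add[symmetric] algebra_simps)
  also have "\<dots> = (\<integral>\<^sup>+\<omega>. ?f \<omega> \<partial>M) * (\<integral>\<^sup>+\<omega>. ?g \<omega> \<partial>M)"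
  proof (rule nn_integral_gen_mult)
    show "{(True, l, j)} \<subseteq> coords" "{(False, l, j)} \<subseteq> coords" "{(True, l, j)} \<inter> {(False, l, j)} = {}"
      using assms by auto
    show "?f \<in> borel_measurable (gen {(True, l, j)})" by measurable
    show "?g \<in> borel_measurable (gen {(False, l, j)})" by measurable
  qed
  also have "\<dots> \<le> 1 * 1"
    by (intro mult_mono nn_integral_reward_lower nn_integral_delay assms) auto
  finally show ?thesis by simp
qed

lemma measurable_q_compose:
  assumes "\<And>x. x \<in> q k ` space M \<Longrightarrow> f x \<in> measurable M N"
  shows "(\<lambda>\<omega>. f (q k \<omega>) \<omega>) \<in> measurable M N"
proof (rule measurable_compose_countable'[where g = "q k" and I = "q k ` space M"])
  show "q k \<in> measurable M (count_space (q k ` space M))"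
  proof (subst measurable_count_space_eq2)
    show "finite (q k ` space M)" by (rule finite_range_q)
    have "q k -` {x} \<inter> space M \<in> sets M" for x
      using subsetD[OF sets_gen_subset q_meas[of k x, unfolded hist_def]] by (simp add: vimage_def Int_def conj_commute)
    then show "q k \<in> space M \<rightarrow> q k ` space M \<and> (\<forall>a\<in>q k ` space M. q k -` {a} \<inter> space M \<in> sets M)"
      by auto
  qed
qed (use assms countable_finite[OF finite_range_q] in auto)

lemma measurable_act [measurable]: "Measurable.pred M (\<lambda>\<omega>. j \<in> act k \<omega>)"
  using measurable_q_compose[where f = "\<lambda>x _. j \<in> fst (fst x)" and k = k and N = "count_space UNIV"]
  by (simp add: fst_q odaaf_run.active_def[OF run])

lemma measurable_tot: "(\<lambda>\<omega>. tot (Suc k) \<omega> j) \<in> borel_measurable M"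
proof -
  have "(\<lambda>\<omega>. phase_sum n (rew \<omega>) (del \<omega>) (Suc k) (fst (q k \<omega>)) j) \<in> borel_measurable M"
  proof (rule measurable_q_compose[where f = "\<lambda>x \<omega>. phase_sum n (rew \<omega>) (del \<omega>) (Suc k) (fst x) j"])
    fix x assume "x \<in> q k ` space M"
    then obtain \<omega> where "fst x = st k \<omega>" by (auto simp: fst_q)
    then show "(\<lambda>\<omega>. phase_sum n (rew \<omega>) (del \<omega>) (Suc k) (fst x) j) \<in> borel_measurable M"
      using measurable_phase_sum[of k \<omega> j] measurable_gen_imp unfolding hist_def by simp
  qed
  then show ?thesis by (simp add: fst_q odaaf_run.total_Suc[OF run])
qed

lemma AE_rewards: "AE \<omega> in M. \<forall>l j. l \<ge> 1 \<longrightarrow> j \<in> {1..K} \<longrightarrow> R l j \<omega> \<in> {0..1}"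
  using AE_R by (simp add: AE_all_countable AE_impI)

lemma sum_phase_len:
  assumes "n 0 = 0" "\<And>k. k \<le> m \<Longrightarrow> n k \<le> n (Suc k)"
  shows "(\<Sum>k<Suc m. real (phase_len n (Suc k))) = real (n (Suc m))"
  using assms
proof (induction m)
  case (Suc m)
  then show ?case using Suc.prems(2)[of "Suc m"] by (simp add: phase_len_def of_nat_diff)
qed (simp add: phase_len_def)

text \<open>The weight has a Hoeffding factor for each play of \<open>j\<close> and an indicator
  factor for each foreign play. On the event \<open>j\<close> has a block in every phase so far, so
  its plays number \<open>n (Suc m)\<close>, and the compensators of the foreign plays sum to a
  multiple of at most \<open>2 * Etau\<close> per phase.\<close>

lemma prob_total_above:
  assumes j: "j \<in> {1..K}" and u: "u > 0" and n: "n 0 = 0" "\<And>k. k \<le> m \<Longrightarrow> n k \<le> n (Suc k)"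
  shows "prob {\<omega> \<in> space M. j \<in> act m \<omega> \<and> x < tot (Suc m) \<omega> j - real (n (Suc m)) * \<mu> j}
    \<le> exp (- (u * x - real (n (Suc m)) * (u\<^sup>2 / 8) - (exp u - 1) * (2 * real (Suc m) * Etau)))"
proof -
  define h where "h = (\<lambda>k x l r d. if arm x k l = j then u * (r - \<mu> j) - u\<^sup>2 / 8
     else u * of_bool (threshold_in n (Suc k) (fst x) j l \<le> d) - (exp u - 1) * tail (threshold_in n (Suc k) (fst x) j l))"
  let ?W = "weight (\<lambda>k x l r d. ennreal (exp (h k x l r d))) (Suc m)"
  have W: "?W \<in> borel_measurable M \<and> (\<integral>\<^sup>+\<omega>. ?W \<omega> \<partial>M) \<le> 1"
  proof (rule nn_integral_weight[THEN conjunct2])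
    show "(\<lambda>r. ennreal (exp (h k x l r d))) \<in> borel_measurable borel" for k x l d
      unfolding h_def by measurable
    show "(\<integral>\<^sup>+\<omega>. ennreal (exp (h k x l (R l a \<omega>) (D l a \<omega>))) \<partial>M) \<le> 1"
      if "l \<ge> 1" "a \<in> {1..K}" "a = arm x k l" for k x l a
      using nn_integral_reward_upper[OF that(1) j u] nn_integral_delay[OF that(1,2)] that(3)
      unfolding h_def by (cases "a = j") simp_all
  qed
  show ?thesis
  proof (rule prob_le_exp_of_weight[of ?W])
    show "?W \<in> borel_measurable M" "(\<integral>\<^sup>+\<omega>. ?W \<omega> \<partial>M) \<le> 1" using W by auto
    show "{\<omega> \<in> space M. j \<in> act m \<omega> \<and> x < tot (Suc m) \<omega> j - real (n (Suc m)) * \<mu> j} \<in> sets M"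
      using measurable_tot[of m j] by measurable
    show "AE \<omega> in M. \<omega> \<in> {\<omega> \<in> space M. j \<in> act m \<omega> \<and> x < tot (Suc m) \<omega> j - real (n (Suc m)) * \<mu> j} \<longrightarrow>
      ennreal (exp (u * x - real (n (Suc m)) * (u\<^sup>2 / 8) - (exp u - 1) * (2 * real (Suc m) * Etau))) \<le> ?W \<omega>"
      using AE_rewards
    proof (eventually_elim, intro impI)
      fix \<omega>
      assume r: "\<forall>l j. l \<ge> 1 \<longrightarrow> j \<in> {1..K} \<longrightarrow> R l j \<omega> \<in> {0..1}"
      assume "\<omega> \<in> {\<omega> \<in> space M. j \<in> act m \<omega> \<and> x < tot (Suc m) \<omega> j - real (n (Suc m)) * \<mu> j}"
      then have act: "j \<in> act m \<omega>" and x: "x < tot (Suc m) \<omega> j - real (n (Suc m)) * \<mu> j" by auto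
      let ?arm = "\<lambda>k l. phase_arm n (Suc k) (st k \<omega>) l" and ?I = "\<lambda>k. {rnd k \<omega><..rnd (Suc k) \<omega>}"
      let ?c = "\<lambda>k l. threshold_in n (Suc k) (st k \<omega>) j l"
      let ?z = "\<lambda>k l. if ?arm k l = j then R l j \<omega> else of_bool (?c k l \<le> D l (?arm k l) \<omega>)"
      let ?t = "\<lambda>k l. if ?arm k l = j then 0 else tail (?c k l)"
      let ?v = "u * \<mu> j + u\<^sup>2 / 8"
      have tot: "tot (Suc m) \<omega> j \<le> (\<Sum>k<Suc m. \<Sum>l\<in>?I k. ?z k l)"
        by (rule odaaf_run.total_le[OF run _ act]) (use r in auto)
      have h: "h k (q k \<omega>) l (R l (?arm k l) \<omega>) (D l (?arm k l) \<omega>) =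
        u * ?z k l - (if ?arm k l = j then ?v else 0) - (exp u - 1) * ?t k l" for k l
        by (auto simp: h_def arm_def fst_q algebra_simps)
      have phase: "(\<Sum>l\<in>?I k. if ?arm k l = j then ?v else 0) = real (phase_len n (Suc k)) * ?v \<and>
        (\<Sum>l\<in>?I k. ?t k l) \<le> 2 * Etau" if "k < Suc m" for k
      proof -
        have actk: "j \<in> act k \<omega>" using act that odaaf_run.active_decreasing[OF run, of k m] by auto
        show ?thesis
          using odaaf_run.sum_block[OF run actk, of "\<lambda>_. ?v"] odaaf_run.sum_threshold_in[OF run actk tail_sum] by simp
      qed
      have e: "exp u - 1 \<ge> 0" using u by simp
      have plen: "(\<Sum>k<Suc m. real (phase_len n (Suc k))) = real (n (Suc m))"
        using n by (rule sum_phase_len)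
      have "u * x - real (n (Suc m)) * (u\<^sup>2 / 8) - (exp u - 1) * (2 * real (Suc m) * Etau)
        \<le> u * (\<Sum>k<Suc m. \<Sum>l\<in>?I k. ?z k l) - real (n (Suc m)) * ?v - (exp u - 1) * (\<Sum>k<Suc m. 2 * Etau)"
      proof -
        have "u * (x + real (n (Suc m)) * \<mu> j) \<le> u * (\<Sum>k<Suc m. \<Sum>l\<in>?I k. ?z k l)"
          using u x tot by (intro mult_left_mono) auto
        then show ?thesis by (simp add: algebra_simps)
      qed
      also have "\<dots> \<le> (\<Sum>k<Suc m. u * (\<Sum>l\<in>?I k. ?z k l) - real (phase_len n (Suc k)) * ?v - (exp u - 1) * (\<Sum>l\<in>?I k. ?t k l))"
      proof -
        have "(exp u - 1) * (\<Sum>k<Suc m. \<Sum>l\<in>?I k. ?t k l) \<le> (exp u - 1) * (\<Sum>k<Suc m. 2 * Etau)"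
          using phase e by (intro mult_left_mono sum_mono) auto
        then show ?thesis
          unfolding sum_subtractf sum_distrib_left[symmetric] sum_distrib_right[symmetric] plen
          by linarith
      qed
      also have "\<dots> = (\<Sum>k<Suc m. \<Sum>l\<in>?I k. h k (q k \<omega>) l (R l (?arm k l) \<omega>) (D l (?arm k l) \<omega>))"
        unfolding h sum_subtractf sum_distrib_left[symmetric] using phase by simp
      finally show "ennreal (exp (u * x - real (n (Suc m)) * (u\<^sup>2 / 8) - (exp u - 1) * (2 * real (Suc m) * Etau))) \<le> ?W \<omega>"
        unfolding weight_exp by (intro ennreal_leI) simp
    qed
  qed
qed

text \<open>Shortfall of the rewards along the successive leaders, plus the number of their plays
  whose reward misses its block. A phase whose leader is inactive contributes 0, so the exponential
  weight is valid on all outcomes, before survival of the leaders is known.\<close>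

definition deficit :: "nat \<Rightarrow> 'a \<Rightarrow> real" where
  "deficit m \<omega> = (\<Sum>k<m. \<Sum>l\<in>{rnd k \<omega><..rnd (Suc k) \<omega>}.
     if lead k \<omega> \<in> act k \<omega> \<and> phase_arm n (Suc k) (st k \<omega>) l = lead k \<omega>
     then \<mu> (lead k \<omega>) - R l (lead k \<omega>) \<omega> + of_bool (threshold_out n (Suc k) (st k \<omega>) (lead k \<omega>) l \<le> D l (lead k \<omega>) \<omega>)
     else 0)"

lemma measurable_deficit [measurable]: "deficit m \<in> borel_measurable M"
proof (induction m)
  case 0
  then show ?case by (simp add: deficit_def[abs_def])
next
  case (Suc m)
  define f where "f = (\<lambda>x \<omega>. \<Sum>l\<in>{pos x<..pos x + len m x}.
     if snd x \<in> fst (fst x) \<and> phase_arm n (Suc m) (fst x) l = snd x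
     then \<mu> (snd x) - R l (snd x) \<omega> + of_bool (threshold_out n (Suc m) (fst x) (snd x) l \<le> D l (snd x) \<omega>) else 0)"
  have "(\<lambda>\<omega>. f (q m \<omega>) \<omega>) \<in> borel_measurable M"
    by (rule measurable_q_compose) (simp add: f_def)
  moreover have "deficit (Suc m) = (\<lambda>\<omega>. deficit m \<omega> + f (q m \<omega>) \<omega>)"
    unfolding f_def pos_len_q unfolding pos_q fst_q lead_def[symmetric]
    by (simp add: deficit_def[abs_def] odaaf_run.active_def[OF run])
  ultimately show ?case using Suc by simp
qed

text \<open>Only plays of the current leader carry a factor. One weight serves all phases although
  the leader changes, since the leader is part of the state at the start of the phase. A phase has
  at most one leader block, hence one \<open>Etau\<close> per phase.\<close>

lemma prob_deficit_above:
  assumes u: "u > 0" and n: "n 0 = 0" "\<And>k. k \<le> m \<Longrightarrow> n k \<le> n (Suc k)" and E: "Etau \<ge> 0"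
  shows "prob {\<omega> \<in> space M. x < deficit (Suc m) \<omega>}
    \<le> exp (- (u * x - real (n (Suc m)) * (u\<^sup>2 / 8) - (exp u - 1) * (real (Suc m) * Etau)))"
proof -
  define h where "h = (\<lambda>k x l r d. if snd x \<in> fst (fst x) \<and> arm x k l = snd x
     then u * (\<mu> (snd x) - r + of_bool (threshold_out n (Suc k) (fst x) (snd x) l \<le> d)) - u\<^sup>2 / 8
       - (exp u - 1) * tail (threshold_out n (Suc k) (fst x) (snd x) l)
     else 0)"
  let ?W = "weight (\<lambda>k x l r d. ennreal (exp (h k x l r d))) (Suc m)"
  have W: "?W \<in> borel_measurable M \<and> (\<integral>\<^sup>+\<omega>. ?W \<omega> \<partial>M) \<le> 1"
  proof (rule nn_integral_weight[THEN conjunct2])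
    show "(\<lambda>r. ennreal (exp (h k x l r d))) \<in> borel_measurable borel" for k x l d
      unfolding h_def by measurable
    show "(\<integral>\<^sup>+\<omega>. ennreal (exp (h k x l (R l a \<omega>) (D l a \<omega>))) \<partial>M) \<le> 1"
      if "l \<ge> 1" "a \<in> {1..K}" "a = arm x k l" for k x l a
      using nn_integral_reward_delay[OF that(1,2) u] that(3)
      unfolding h_def by (cases "snd x \<in> fst (fst x) \<and> a = snd x") (auto simp: emeasure_space_1)
  qed
  show ?thesis
  proof (rule prob_le_exp_of_weight[of ?W])
    show "?W \<in> borel_measurable M" "(\<integral>\<^sup>+\<omega>. ?W \<omega> \<partial>M) \<le> 1" using W by auto
    show "{\<omega> \<in> space M. x < deficit (Suc m) \<omega>} \<in> sets M" by measurable
    show "AE \<omega> in M. \<omega> \<in> {\<omega> \<in> space M. x < deficit (Suc m) \<omega>} \<longrightarrow>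
      ennreal (exp (u * x - real (n (Suc m)) * (u\<^sup>2 / 8) - (exp u - 1) * (real (Suc m) * Etau))) \<le> ?W \<omega>"
    proof (intro AE_I2 impI)
      fix \<omega>
      assume "\<omega> \<in> {\<omega> \<in> space M. x < deficit (Suc m) \<omega>}"
      then have x: "x < deficit (Suc m) \<omega>" by simp
      let ?arm = "\<lambda>k l. phase_arm n (Suc k) (st k \<omega>) l" and ?I = "\<lambda>k. {rnd k \<omega><..rnd (Suc k) \<omega>}"
      let ?a = "\<lambda>k. lead k \<omega>"
      let ?c = "\<lambda>k l. threshold_out n (Suc k) (st k \<omega>) (?a k) l"
      let ?P = "\<lambda>k l. ?a k \<in> act k \<omega> \<and> ?arm k l = ?a k"
      let ?z = "\<lambda>k l. if ?P k l then \<mu> (?a k) - R l (?a k) \<omega> + of_bool (?c k l \<le> D l (?a k) \<omega>) else 0"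
      let ?v = "\<lambda>k l. if ?P k l then u\<^sup>2 / 8 else 0" and ?t = "\<lambda>k l. if ?P k l then tail (?c k l) else 0"
      have h: "h k (q k \<omega>) l (R l (?arm k l) \<omega>) (D l (?arm k l) \<omega>) =
        u * ?z k l - ?v k l - (exp u - 1) * ?t k l" for k l
        by (auto simp: h_def arm_def fst_q lead_def odaaf_run.active_def[OF run])
      have phase: "(\<Sum>l\<in>?I k. ?v k l) \<le> real (phase_len n (Suc k)) * (u\<^sup>2 / 8) \<and> (\<Sum>l\<in>?I k. ?t k l) \<le> Etau" for k
      proof (cases "?a k \<in> act k \<omega>")
        case True
        then show ?thesis
          using odaaf_run.sum_block[OF run True, of "\<lambda>_. u\<^sup>2 / 8"] odaaf_run.sum_block[OF run True, of "\<lambda>l. tail (?c k l)"]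
            odaaf_run.sum_threshold_out[OF run, where f = tail and E = Etau and j = "?a k" and r = "rew \<omega>" and d = "del \<omega>" and n = n and m = k] tail_sum by simp
      next
        case False
        then show ?thesis using E by simp
      qed
      have e: "exp u - 1 \<ge> 0" using u by simp
      have plen: "(\<Sum>k<Suc m. real (phase_len n (Suc k))) = real (n (Suc m))"
        using n by (rule sum_phase_len)
      have "u * x - real (n (Suc m)) * (u\<^sup>2 / 8) - (exp u - 1) * (real (Suc m) * Etau)
        \<le> u * (\<Sum>k<Suc m. \<Sum>l\<in>?I k. ?z k l) - (\<Sum>k<Suc m. real (phase_len n (Suc k)) * (u\<^sup>2 / 8)) - (exp u - 1) * (\<Sum>k<Suc m. Etau)"
      proof -
        have "u * x \<le> u * (\<Sum>k<Suc m. \<Sum>l\<in>?I k. ?z k l)"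
          using u x unfolding deficit_def by (intro mult_left_mono) auto
        then show ?thesis
          unfolding sum_distrib_right[symmetric] plen by simp
      qed
      also have "\<dots> \<le> (\<Sum>k<Suc m. u * (\<Sum>l\<in>?I k. ?z k l) - (\<Sum>l\<in>?I k. ?v k l) - (exp u - 1) * (\<Sum>l\<in>?I k. ?t k l))"
      proof -
        have 1: "(exp u - 1) * (\<Sum>k<Suc m. \<Sum>l\<in>?I k. ?t k l) \<le> (exp u - 1) * (\<Sum>k<Suc m. Etau)"
          using phase e by (intro mult_left_mono sum_mono) auto
        have 2: "(\<Sum>k<Suc m. \<Sum>l\<in>?I k. ?v k l) \<le> (\<Sum>k<Suc m. real (phase_len n (Suc k)) * (u\<^sup>2 / 8))"
          using phase by (intro sum_mono) auto
        show ?thesis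
          using 1 2 unfolding sum_subtractf sum_distrib_left[symmetric] by linarith
      qed
      also have "\<dots> = (\<Sum>k<Suc m. \<Sum>l\<in>?I k. h k (q k \<omega>) l (R l (?arm k l) \<omega>) (D l (?arm k l) \<omega>))"
        unfolding h sum_subtractf sum_distrib_left[symmetric] by simp
      finally show "ennreal (exp (u * x - real (n (Suc m)) * (u\<^sup>2 / 8) - (exp u - 1) * (real (Suc m) * Etau))) \<le> ?W \<omega>"
        unfolding weight_exp by (intro ennreal_leI) simp
    qed
  qed
qed

text \<open>At a handover the new leader has the highest total among the optimal arms of the
  finished phase, so the change loses nothing and the shortfalls of different arms add up as if one
  arm had been followed. The leader stays active: no optimal arm is ahead of it, and a suboptimal
  one is ahead by at most 1/2 + 2/5 of the tolerance.\<close>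

lemma leader_chain:
  assumes best: "best \<noteq> {}" "best \<subseteq> {1..K}" and mu: "\<And>j. j \<in> best \<Longrightarrow> \<mu> j = \<mu>star"
      "\<And>j. j \<in> {1..K} \<Longrightarrow> \<mu> j \<le> \<mu>star"
    and n: "n 0 = 0" "\<And>k. k < m \<Longrightarrow> n k \<le> n (Suc k)" "\<And>k. k < m \<Longrightarrow> n (Suc k) > 0"
    and r: "\<And>l j. l \<ge> 1 \<Longrightarrow> j \<in> {1..K} \<Longrightarrow> R l j \<omega> \<in> {0..1}"
    and G: "\<And>k. k < m \<Longrightarrow> deficit (Suc k) \<omega> \<le> 2 / 5 * (real (n (Suc k)) * 2 powr (- real (Suc k)))"
    and F: "\<And>k i. k < m \<Longrightarrow> i \<in> act k \<omega> - best \<Longrightarrow>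
       tot (Suc k) \<omega> i - real (n (Suc k)) * \<mu> i \<le> 1 / 2 * (real (n (Suc k)) * 2 powr (- real (Suc k)))"
  shows "lead m \<omega> \<in> best \<inter> act m \<omega> \<and> real (n m) * \<mu>star - deficit m \<omega> \<le> tot m \<omega> (lead m \<omega>)"
  using n G F
proof (induction m)
  case 0
  obtain b where "b \<in> best" using best by auto
  then have "lead 0 \<omega> \<in> best" unfolding lead_def using LeastI[of "\<lambda>j. j \<in> best" b] by simp
  then show ?case using best 0
    by (auto simp: odaaf_run.active_0[OF run] deficit_def odaaf_run.total_def[OF run] odaaf_run.idx_0[OF run])
next
  case (Suc m)
  let ?a = "lead m \<omega>" and ?N = "real (n (Suc m))" and ?T = "tot (Suc m) \<omega>"
  let ?tol = "2 powr (- real (Suc m)) :: real"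
  have IH: "?a \<in> best \<inter> act m \<omega>" "real (n m) * \<mu>star - deficit m \<omega> \<le> tot m \<omega> ?a"
    using Suc.IH Suc.prems by auto
  have mono: "n k \<le> n (Suc k)" if "k \<le> m" for k using Suc.prems(2) that by simp
  let ?B = "{bst m \<omega> ?a<..bst m \<omega> ?a + phase_len n (Suc m)}"
  let ?o = "\<lambda>l. of_bool (threshold_out n (Suc m) (st m \<omega>) ?a l \<le> D l ?a \<omega>) :: real"
  have "deficit (Suc m) \<omega> = deficit m \<omega> + (\<Sum>l\<in>?B. \<mu> ?a - R l ?a \<omega> + ?o l)"
    using IH(1) odaaf_run.sum_block[OF run, where j = ?a and r = "rew \<omega>" and d = "del \<omega>" and n = n and m = m, symmetric] by (simp add: deficit_def)
  also have "(\<Sum>l\<in>?B. \<mu> ?a - R l ?a \<omega> + ?o l) = real (phase_len n (Suc m)) * \<mu>star - (\<Sum>l\<in>?B. R l ?a \<omega> - ?o l)"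
    using IH(1) mu by (simp add: sum.distrib sum_subtractf)
  finally have def: "deficit (Suc m) \<omega> = deficit m \<omega> + real (phase_len n (Suc m)) * \<mu>star - (\<Sum>l\<in>?B. R l ?a \<omega> - ?o l)"
    by simp
  have "tot m \<omega> ?a + (\<Sum>l\<in>?B. R l ?a \<omega> - ?o l) \<le> ?T ?a"
    by (rule odaaf_run.total_Suc_ge[OF run]) (use r IH in auto)
  moreover have "?N * \<mu>star = real (n m) * \<mu>star + real (phase_len n (Suc m)) * \<mu>star"
    using mono[of m] by (simp add: phase_len_def of_nat_diff algebra_simps)
  ultimately have Ta: "?N * \<mu>star - deficit (Suc m) \<omega> \<le> ?T ?a"
    using IH(2) def by linarith
  let ?C = "best \<inter> act m \<omega>" and ?b = "lead (Suc m) \<omega>"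
  have "\<exists>j. j \<in> ?C \<and> (\<forall>i\<in>?C. ?T i \<le> ?T j)"
  proof -
    have fin: "finite (?T ` ?C)" "?T ` ?C \<noteq> {}" using odaaf_run.finite_active[OF run] IH(1) by auto
    from Max_in[OF this] obtain j where "j \<in> ?C" "Max (?T ` ?C) = ?T j" by auto
    then show ?thesis using Max_ge[OF fin(1)] by (metis imageI)
  qed
  from LeastI_ex[OF this] have b: "?b \<in> ?C" "\<And>i. i \<in> ?C \<Longrightarrow> ?T i \<le> ?T ?b"
    unfolding lead_Suc by blast+
  have Tb: "?N * \<mu>star - deficit (Suc m) \<omega> \<le> ?T ?b" using Ta b(2)[OF IH(1)] by linarith
  have "?b \<in> act (Suc m) \<omega>"
  proof (rule odaaf_run.active_SucI[OF run n(1) mono])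
    show "0 < n (Suc m)" using Suc.prems(3) by simp
    show "?b \<in> act m \<omega>" using b by simp
    fix i assume i: "i \<in> act m \<omega>"
    show "?T i \<le> ?T ?b + ?N * ?tol"
    proof (cases "i \<in> best")
      case True
      then have "?T i \<le> ?T ?b" using b i by simp
      then show ?thesis by (simp add: add_increasing2)
    next
      case False
      have "\<mu> i \<le> \<mu>star" using i mu(2) odaaf_run.active_subset[OF run] by blast
      then have "?N * \<mu> i \<le> ?N * \<mu>star" by (intro mult_left_mono) auto
      moreover have "?T i - ?N * \<mu> i \<le> 1 / 2 * (?N * ?tol)" using Suc.prems(5)[of m i] i False by simp
      moreover have "deficit (Suc m) \<omega> \<le> 2 / 5 * (?N * ?tol)" using Suc.prems(4)[of m] by simp
      moreover have "0 \<le> ?N * ?tol" by simp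
      ultimately show ?thesis using Tb by linarith
    qed
  qed
  then show ?case using b Tb by blast
qed

text \<open>In units of the tolerance, the average of the arm is more than 19/10 - 1/2 below the
  optimal mean and that of the leader at most 2/5 below it. The difference exceeds 1.\<close>

lemma eliminated:
  assumes best: "best \<noteq> {}" "best \<subseteq> {1..K}" and mu: "\<And>j. j \<in> best \<Longrightarrow> \<mu> j = \<mu>star"
      "\<And>j. j \<in> {1..K} \<Longrightarrow> \<mu> j \<le> \<mu>star"
    and n: "n 0 = 0" "\<And>k. k \<le> m \<Longrightarrow> n k \<le> n (Suc k)" "\<And>k. k \<le> m \<Longrightarrow> n (Suc k) > 0"
    and r: "\<And>l j. l \<ge> 1 \<Longrightarrow> j \<in> {1..K} \<Longrightarrow> R l j \<omega> \<in> {0..1}"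
    and G: "\<And>k. k \<le> m \<Longrightarrow> deficit (Suc k) \<omega> \<le> 2 / 5 * (real (n (Suc k)) * 2 powr (- real (Suc k)))"
    and F: "\<And>k i. k \<le> m \<Longrightarrow> i \<in> act k \<omega> - best \<Longrightarrow>
       tot (Suc k) \<omega> i - real (n (Suc k)) * \<mu> i \<le> 1 / 2 * (real (n (Suc k)) * 2 powr (- real (Suc k)))"
    and j: "19 / 10 * 2 powr (- real (Suc m)) < \<mu>star - \<mu> j"
  shows "j \<notin> act (Suc m) \<omega>"
proof (cases "j \<in> act m \<omega>")
  case True
  let ?N = "real (n (Suc m))" and ?T = "tot (Suc m) \<omega>" and ?b = "lead (Suc m) \<omega>"
  let ?tol = "2 powr (- real (Suc m)) :: real"
  have b: "?b \<in> act (Suc m) \<omega>" "?N * \<mu>star - deficit (Suc m) \<omega> \<le> ?T ?b"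
    using leader_chain[of \<mu>star "Suc m" \<omega>] best mu n r G F by (auto simp: less_Suc_eq_le)
  have N: "n (Suc m) > 0" using n(3) by simp
  have "j \<notin> best"
  proof
    assume "j \<in> best"
    then have "19 / 10 * ?tol < 0" using j mu(1) by simp
    moreover have "0 < 19 / 10 * ?tol" by simp
    ultimately show False by linarith
  qed
  then have Tj: "?T j - ?N * \<mu> j \<le> 1 / 2 * (?N * ?tol)" using F[of m j] True by simp
  have "?N * (19 / 10 * ?tol) < ?N * (\<mu>star - \<mu> j)" using j N by (intro mult_strict_left_mono) auto
  then have "19 / 10 * (?N * ?tol) < ?N * \<mu>star - ?N * \<mu> j" by (simp add: right_diff_distrib)
  moreover have "deficit (Suc m) \<omega> \<le> 2 / 5 * (?N * ?tol)" using G[of m] by simp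
  ultimately have lt: "?T j + ?N * ?tol < ?T ?b" using Tj b(2) by linarith
  show ?thesis
  proof (rule odaaf_run.not_active_SucI[OF run n(1,2) N True])
    show "?b \<in> act m \<omega>" using b(1) odaaf_run.active_decreasing[OF run, of m "Suc m"] by auto
  qed (use lt in auto)
next
  case False
  then show ?thesis using odaaf_run.active_decreasing[OF run, of m "Suc m"] by auto
qed

end

section \<open>Tail exponents and elimination phases\<close>

lemma exp_half_tolerance:
  assumes "0 < D" "D \<le> (1/2 :: real)"
  shows "exp (D / 2) - 1 \<le> 5 / 8 * D"
proof -
  have "exp (D / 2) \<le> 1 + D / 2 + (D / 2)\<^sup>2" using assms by (intro exp_bound) auto
  moreover have "D\<^sup>2 \<le> 1 / 2 * D" using assms by (simp add: power2_eq_square)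
  ultimately show ?thesis by (simp add: power_divide)
qed

text \<open>After the Hoeffding term, \<open>1/4 - 1/32 = 7/32\<close> and
  \<open>1/5 - 1/32 = 27/160\<close> of \<open>N D^2\<close> remain. Multiplied by
  \<open>8 L + 6 D m E\<close> these give 7/4 and 27/20 of \<open>L\<close>, and 21/16 and 81/80 of
  \<open>D m E\<close>, where 5/4 and 5/8 are consumed.\<close>

lemma
  fixes D L E N :: real and m :: nat
  assumes D: "0 < D" "D \<le> 1 / 2" and L: "L \<ge> 0" and E: "E \<ge> 0"
    and N: "8 * L + 6 * D * real m * E \<le> N * D\<^sup>2"
  shows exponent_above: "L \<le> D / 2 * (1 / 2 * (N * D)) - N * ((D / 2)\<^sup>2 / 8) - (exp (D / 2) - 1) * (2 * real m * E)"
    and exponent_deficit: "L \<le> D / 2 * (2 / 5 * (N * D)) - N * ((D / 2)\<^sup>2 / 8) - (exp (D / 2) - 1) * (real m * E)"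
proof -
  have e: "(exp (D / 2) - 1) * (real m * E) \<le> 5 / 8 * D * (real m * E)"
    using exp_half_tolerance[OF D] E by (intro mult_right_mono) auto
  have p: "0 \<le> D * real m * E" using D E by simp
  have "7 / 32 * (8 * L + 6 * D * real m * E) \<le> 7 / 32 * (N * D\<^sup>2)"
    using N by (intro mult_left_mono) auto
  then show "L \<le> D / 2 * (1 / 2 * (N * D)) - N * ((D / 2)\<^sup>2 / 8) - (exp (D / 2) - 1) * (2 * real m * E)"
    using e p L by (simp add: power2_eq_square algebra_simps)
  have "27 / 160 * (8 * L + 6 * D * real m * E) \<le> 27 / 160 * (N * D\<^sup>2)"
    using N by (intro mult_left_mono) auto
  then show "L \<le> D / 2 * (2 / 5 * (N * D)) - N * ((D / 2)\<^sup>2 / 8) - (exp (D / 2) - 1) * (real m * E)"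
    using e p L by (simp add: power2_eq_square algebra_simps)
qed

text \<open>The phase by whose end an arm of gap \<open>x\<close> should be gone.  The factor 19/10 instead of the
  customary 2 leaves room for the second-order term of (N1).\<close>

definition last_phase :: "real \<Rightarrow> nat" where
  "last_phase x = (LEAST m. 19 / 10 * 2 powr (- real m) < x)"

lemma
  assumes x: "0 < x" "x \<le> 1"
  shows last_phase_tolerance: "19 / 10 * 2 powr (- real (last_phase x)) < x"
    and last_phase_pos: "last_phase x > 0"
    and last_phase_ge: "x \<le> 19 / 5 * 2 powr (- real (last_phase x))"
proof -
  obtain m where "(1 / 2 :: real) ^ m < x * (10 / 19)"
    using real_arch_pow_inv[of "x * (10 / 19)" "1 / 2"] x by auto
  then have "19 / 10 * 2 powr (- real m) < x" by (simp add: phase_tolerance power_one_over)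
  then show tol: "19 / 10 * 2 powr (- real (last_phase x)) < x"
    unfolding last_phase_def by (rule LeastI)
  \<comment> \<open>Phase 0 has tolerance 1, and 19/10 exceeds every gap.\<close>
  then show pos: "last_phase x > 0" using x by (intro gr0I) auto
  then obtain p where p: "last_phase x = Suc p" using gr0_implies_Suc by blast
  then have "\<not> 19 / 10 * 2 powr (- real p) < x"
    unfolding last_phase_def by (metis lessI not_less_Least)
  then show "x \<le> 19 / 5 * 2 powr (- real (last_phase x))"
    unfolding p phase_tolerance by simp
qed

lemma two_power_last_phase:
  assumes "0 < x" "x \<le> 1"
  shows "2 ^ last_phase x \<le> 19 / 5 / x"
  using last_phase_ge[OF assms] assms by (simp add: phase_tolerance field_simps)

text \<open>Minimality of the last phase gives \<open>x <= 19/5 D\<close>, hence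
  \<open>T D^2 > 400 (5/19)^2\<close>, well above the 4 that makes (N1) increasing.\<close>

lemma odaaf_L_last_phase:
  assumes x: "0 < x" "x \<le> 1" and T: "400 < real T * x\<^sup>2" and m: "m \<le> last_phase x"
  shows "ln 4 \<le> odaaf_L T m"
proof -
  let ?D = "2 powr (- real m) :: real"
  have "2 powr (- real (last_phase x)) \<le> ?D" using m by (intro powr_mono) auto
  then have "x \<le> 19 / 5 * ?D" using last_phase_ge[OF x] by linarith
  then have "x\<^sup>2 \<le> (19 / 5 * ?D)\<^sup>2" using x by (intro power_mono) auto
  then have "real T * x\<^sup>2 \<le> real T * (19 / 5 * ?D)\<^sup>2" by (intro mult_left_mono) auto
  then have "400 < real T * (19 / 5 * ?D)\<^sup>2" using T by linarith
  then have "400 < 361 / 25 * (real T * ?D\<^sup>2)" by (simp only: power_mult_distrib) (simp add: power2_eq_square)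
  then have "4 \<le> real T * ?D\<^sup>2" by simp
  then show ?thesis unfolding odaaf_L_def by simp
qed

lemma odaaf_n_last_phase:
  assumes x: "0 < x" "x \<le> 1" and T: "400 < real T * x\<^sup>2" and E: "E \<ge> 0"
  shows "x * real (odaaf_n T E (last_phase x)) \<le>
    128 * ln (real T * x\<^sup>2) / x + 32 / 3 * ln (real T * x\<^sup>2) + 96 * ln (4 / x) * E + x"
proof -
  define m where "m = last_phase x"
  define D L \<Lambda> where "D = 2 powr (- real m)" and "L = odaaf_L T m" and "\<Lambda> = ln (real T * x\<^sup>2)"
  have D: "0 < D" "D \<le> x" "x \<le> 19 / 5 * D"
    using last_phase_tolerance[OF x] last_phase_ge[OF x] by (auto simp: D_def m_def)
  have Tp: "real T > 0" using T x by (cases "T = 0") auto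
  have L0: "0 \<le> L" using odaaf_L_last_phase[OF x T, of m] by (simp add: L_def m_def) (smt (verit) ln_ge_zero)
  have "real T * D\<^sup>2 \<le> real T * x\<^sup>2" using D by (intro mult_left_mono power_mono) auto
  then have L\<Lambda>: "L \<le> \<Lambda>" unfolding L_def odaaf_L_def \<Lambda>_def D_def[symmetric] using Tp D by simp
  then have \<Lambda>0: "0 \<le> \<Lambda>" using L0 by linarith
  define y where "y = x / D"
  have y: "0 < y" "y \<le> 19 / 5" using x D by (auto simp: y_def pos_divide_le_eq)
  have yy: "y * y \<le> 361 / 25" using mult_mono[OF y(2) y(2)] y by simp
  have "x * real (odaaf_n T E m) \<le> x * (1 + (8 * L + 16 / 3 * D * L + 12 * D * real m * E) / D\<^sup>2)"
    using odaaf_n_upper[OF E, of m T] last_phase_pos[OF x] L0 x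
    by (intro mult_left_mono) (auto simp: D_def L_def m_def)
  also have "\<dots> = x + y * y * 8 * L / x + 16 / 3 * y * L + 12 * y * real m * E"
    using x D by (simp add: y_def field_simps power2_eq_square)
  also have "\<dots> \<le> x + 361 / 25 * 8 * \<Lambda> / x + 16 / 3 * (19 / 5) * \<Lambda> + 12 * (19 / 5) * real m * E"
    using y yy x L0 L\<Lambda> \<Lambda>0 E by (intro add_mono divide_right_mono mult_mono) auto
  also have "\<dots> \<le> 128 * \<Lambda> / x + 32 / 3 * \<Lambda> + 96 * ln (4 / x) * E + x"
  proof -
    \<comment> \<open>The leading coefficient \<open>8 (19/5)^2 = 115.52\<close> stays 12.48 below
      128. Since \<open>x <= 1\<close>, this covers the 9.6 by which \<open>16/3 * 19/5\<close>
      exceeds \<open>32/3\<close>.\<close>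
    have "\<Lambda> \<le> \<Lambda> / x" using x \<Lambda>0 by (simp add: pos_le_divide_eq mult_left_le)
    \<comment> \<open>\<open>2^m <= 4 / x\<close> turns the phase number into a logarithm; by
      \<open>ln 2 >= 2/3\<close> the right side is at least \<open>64 m\<close>, against
      \<open>45.6 m\<close> on the left, both times \<open>E\<close>.\<close>
    moreover have "12 * (19 / 5) * real m * E \<le> 96 * ln (4 / x) * E"
    proof (rule mult_right_mono[OF _ E])
      have "ln (2 ^ m) \<le> ln (4 / x)"
        using two_power_last_phase[OF x] x by (subst ln_le_cancel_iff) (auto simp: m_def field_simps)
      then have "real m * ln 2 \<le> ln (4 / x)" by (simp add: ln_realpow)
      moreover have "real m * (2 / 3) \<le> real m * ln 2"
        using ln2_ge_two_thirds by (intro mult_left_mono) auto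
      ultimately show "12 * (19 / 5) * real m \<le> 96 * ln (4 / x)" by linarith
    qed
    moreover have "361 / 25 * 8 * \<Lambda> / x = 2888 / 25 * (\<Lambda> / x)" "128 * \<Lambda> / x = 128 * (\<Lambda> / x)" by simp_all
    ultimately show ?thesis using \<Lambda>0 by linarith
  qed
  finally show ?thesis by (simp add: m_def \<Lambda>_def)
qed

section \<open>Regret\<close>

locale odaaf_regret = odaaf_bandit M K R D "odaaf_n T Etau" \<mu> tail Etau best
  for M :: "'a measure" and K R D and T :: nat and \<mu> tail Etau best +
  fixes \<mu>star :: real
  assumes T_pos: "T > 0" and Etau_nonneg: "Etau \<ge> 0"
    and best_eq: "best = {j \<in> {1..K}. \<mu> j = \<mu>star}" and best_nonempty: "best \<noteq> {}"
    and gap_range: "\<And>j. j \<in> {1..K} \<Longrightarrow> 0 \<le> \<mu>star - \<mu> j \<and> \<mu>star - \<mu> j \<le> 1"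
begin

abbreviation N where "N \<equiv> odaaf_n T Etau"
definition gap where "gap j = \<mu>star - \<mu> j"
definition subopt where "subopt = {j \<in> {1..K}. gap j > 0}"
definition big where "big = {j \<in> subopt. 400 < real T * (gap j)\<^sup>2}"
text \<open>The last phase in which an arm of \<open>big\<close> is still due, not the number of
  rounds \<open>T\<close>. Only the phases up to this one are analysed.\<close>

definition horizon where "horizon = Max (insert 0 ((\<lambda>j. last_phase (gap j)) ` big))"
definition scale where "scale m = real (N (Suc m)) * 2 powr (- real (Suc m))"

definition over where
  "over m i = {\<omega> \<in> space M. i \<in> act m \<omega> \<and> 1 / 2 * scale m < tot (Suc m) \<omega> i - real (N (Suc m)) * \<mu> i}"
definition under where "under m = {\<omega> \<in> space M. 2 / 5 * scale m < deficit (Suc m) \<omega>}"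
definition regret where
  "regret \<omega> = (\<Sum>t\<in>{1..T}. gap (odaaf_arm K N (rew \<omega>) (del \<omega>) t))"

text \<open>The suboptimal arms that may still be active in phase \<open>m + 1\<close> if no estimate was bad before.\<close>

definition alive where "alive m = {i \<in> subopt. i \<in> big \<longrightarrow> m < last_phase (gap i)}"

lemma finite_subopt: "finite subopt" and big_subset: "big \<subseteq> subopt" and finite_big: "finite big"
  by (auto simp: subopt_def big_def)

lemma gap: "j \<in> {1..K} \<Longrightarrow> 0 \<le> gap j \<and> gap j \<le> 1"
  using gap_range by (simp add: gap_def)

lemma gap_subopt: "j \<in> subopt \<Longrightarrow> 0 < gap j \<and> gap j \<le> 1"
  using gap[of j] by (simp add: subopt_def)

lemma subopt_eq: "subopt = {1..K} - best"
proof (intro set_eqI)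
  show "j \<in> subopt \<longleftrightarrow> j \<in> {1..K} - best" for j
    using gap_range[of j] unfolding subopt_def gap_def best_eq by auto
qed

lemma gap_big: "j \<in> big \<Longrightarrow> 0 < gap j \<and> gap j \<le> 1 \<and> 400 < real T * (gap j)\<^sup>2"
  using gap_subopt[of j] by (simp add: big_def)

lemma last_phase_le_horizon: "j \<in> big \<Longrightarrow> last_phase (gap j) \<le> horizon"
  unfolding horizon_def using finite_big by (intro Max_ge) auto

lemma horizon_attained:
  assumes "horizon > 0"
  obtains j where "j \<in> big" "last_phase (gap j) = horizon"
proof -
  have "horizon \<in> insert 0 ((\<lambda>j. last_phase (gap j)) ` big)"
    unfolding horizon_def using finite_big by (intro Max_in) auto
  then show ?thesis using assms that by auto
qed

lemma L_ge:
  assumes "m < horizon"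
  shows "ln 4 \<le> odaaf_L T (Suc m)"
proof -
  obtain j where "j \<in> big" "last_phase (gap j) = horizon" using assms horizon_attained by auto
  then show ?thesis using odaaf_L_last_phase[of "gap j" T "Suc m"] gap_big assms by auto
qed

lemma L_nonneg: "m < horizon \<Longrightarrow> 0 \<le> odaaf_L T (Suc m)"
  using L_ge[of m] ln_ge_zero[of 4] by linarith

lemma N_0: "N 0 = 0" by (simp add: odaaf_n_def)

lemma N_mono: "m < horizon \<Longrightarrow> N m \<le> N (Suc m)"
  using odaaf_n_Suc_ge[OF Etau_nonneg T_pos L_ge] .

lemma N_lower:
  assumes "m < horizon"
  shows "8 * odaaf_L T (Suc m) + 6 * 2 powr (- real (Suc m)) * real (Suc m) * Etau
    \<le> real (N (Suc m)) * (2 powr (- real (Suc m)))\<^sup>2"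
  using odaaf_n_lower[OF Etau_nonneg _ L_nonneg[OF assms]] by simp

lemma N_pos:
  assumes "m < horizon"
  shows "N (Suc m) > 0"
proof (rule ccontr)
  assume "\<not> N (Suc m) > 0"
  then have "8 * odaaf_L T (Suc m) + 6 * 2 powr (- real (Suc m)) * real (Suc m) * Etau \<le> 0"
    using N_lower[OF assms] by simp
  moreover have "0 \<le> 6 * 2 powr (- real (Suc m)) * real (Suc m) * Etau" using Etau_nonneg by simp
  moreover have "0 < ln (4::real)" by simp
  ultimately show False using L_ge[OF assms] by linarith
qed

lemma tolerance_le: "(2::real) powr (- real (Suc m)) \<le> 1 / 2"
  by (simp only: phase_tolerance) simp

lemma prob_over:
  assumes "m < horizon" "i \<in> {1..K}"
  shows "prob (over m i) \<le> 4 ^ Suc m / real T"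
proof -
  let ?D = "2 powr (- real (Suc m)) :: real"
  have "prob (over m i) \<le> exp (- (?D / 2 * (1 / 2 * scale m) - real (N (Suc m)) * ((?D / 2)\<^sup>2 / 8)
      - (exp (?D / 2) - 1) * (2 * real (Suc m) * Etau)))"
    unfolding over_def using assms N_mono by (intro prob_total_above N_0) auto
  also have "\<dots> \<le> exp (- odaaf_L T (Suc m))"
    unfolding scale_def
    using exponent_above[OF _ tolerance_le L_nonneg[OF assms(1)] Etau_nonneg N_lower[OF assms(1)]] by simp
  also have "\<dots> = 4 ^ Suc m / real T" by (rule exp_odaaf_L[OF T_pos])
  finally show ?thesis .
qed

lemma prob_under:
  assumes "m < horizon"
  shows "prob (under m) \<le> 4 ^ Suc m / real T"
proof -
  let ?D = "2 powr (- real (Suc m)) :: real"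
  have "prob (under m) \<le> exp (- (?D / 2 * (2 / 5 * scale m) - real (N (Suc m)) * ((?D / 2)\<^sup>2 / 8)
      - (exp (?D / 2) - 1) * (real (Suc m) * Etau)))"
    unfolding under_def using assms N_mono by (intro prob_deficit_above N_0 Etau_nonneg) auto
  also have "\<dots> \<le> exp (- odaaf_L T (Suc m))"
    unfolding scale_def
    using exponent_deficit[OF _ tolerance_le L_nonneg[OF assms(1)] Etau_nonneg N_lower[OF assms(1)]] by simp
  also have "\<dots> = 4 ^ Suc m / real T" by (rule exp_odaaf_L[OF T_pos])
  finally show ?thesis .
qed

lemma over_sets: "over m i \<in> sets M" and under_sets: "under m \<in> sets M"
proof -
  have [measurable]: "(\<lambda>\<omega>. tot (Suc m) \<omega> i) \<in> borel_measurable M" by (rule measurable_tot)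
  show "over m i \<in> sets M" unfolding over_def by measurable
  show "under m \<in> sets M" unfolding under_def by measurable
qed

text \<open>Overestimates count only for arms still due to be active, so that the charges to an arm
  form a geometric sum of order \<open>1 / gap\<close>.\<close>

definition bad where "bad m \<omega> \<longleftrightarrow> \<omega> \<in> under m \<or> (\<exists>i\<in>alive m. \<omega> \<in> over m i)"

context
  fixes \<omega>
  assumes \<omega>: "\<omega> \<in> space M" and r: "\<And>l j. l \<ge> 1 \<Longrightarrow> j \<in> {1..K} \<Longrightarrow> R l j \<omega> \<in> {0..1}"
begin

lemma eliminated_in_time:
  assumes p: "j \<in> big" "last_phase (gap j) = Suc p"
    and G: "\<And>k. k \<le> p \<Longrightarrow> \<omega> \<notin> under k"
    and F: "\<And>k i. k \<le> p \<Longrightarrow> i \<in> act k \<omega> - best \<Longrightarrow> \<omega> \<notin> over k i"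
  shows "j \<notin> act (Suc p) \<omega>"
proof (rule eliminated[of \<mu>star])
  have hor: "k < horizon" if "k \<le> p" for k using last_phase_le_horizon[OF p(1)] p(2) that by simp
  show "best \<noteq> {}" "best \<subseteq> {1..K}" "N 0 = 0" using best_nonempty best_eq N_0 by auto
  show "\<mu> j = \<mu>star" if "j \<in> best" for j using that best_eq by simp
  show "\<mu> j \<le> \<mu>star" if "j \<in> {1..K}" for j using that gap_range[of j] by simp
  show "N k \<le> N (Suc k)" "N (Suc k) > 0" if "k \<le> p" for k using N_mono N_pos hor that by auto
  show "R l j \<omega> \<in> {0..1}" if "l \<ge> 1" "j \<in> {1..K}" for l j by (rule r[OF that])
  show "deficit (Suc k) \<omega> \<le> 2 / 5 * (real (N (Suc k)) * 2 powr (- real (Suc k)))" if "k \<le> p" for k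
    using G[OF that] \<omega> unfolding under_def scale_def by (simp add: not_less)
  show "tot (Suc k) \<omega> i - real (N (Suc k)) * \<mu> i \<le> 1 / 2 * (real (N (Suc k)) * 2 powr (- real (Suc k)))"
    if "k \<le> p" "i \<in> act k \<omega> - best" for k i
    using F[OF that] that(2) \<omega> unfolding over_def scale_def by (simp add: not_less)
  show "19 / 10 * 2 powr (- real (Suc p)) < \<mu>star - \<mu> j"
    using last_phase_tolerance[of "gap j"] gap_big[OF p(1)] p(2) by (simp add: gap_def)
qed

text \<open>Strong induction: an arm past its last phase has been eliminated, provided no suboptimal
  arm active earlier was overestimated, which is the induction hypothesis. Controlling the arms of
  \<open>alive\<close> thus controls every active suboptimal arm.\<close>

lemma not_over:
  assumes "\<And>k. k < m \<Longrightarrow> \<not> bad k \<omega>" "k < m" "i \<in> act k \<omega> - best"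
  shows "\<omega> \<notin> over k i"
  using assms(2,3)
proof (induction k arbitrary: i rule: less_induct)
  case (less k)
  have i: "i \<in> subopt" using less.prems odaaf_run.active_subset[OF run] subopt_eq by blast
  show ?case
  proof (cases "i \<in> alive k")
    case True
    then show ?thesis using assms(1)[OF less.prems(1)] by (auto simp: bad_def)
  next
    case False
    then have big: "i \<in> big" "last_phase (gap i) \<le> k" using i by (auto simp: alive_def)
    obtain p where p: "last_phase (gap i) = Suc p"
      using last_phase_pos gap_big[OF big(1)] gr0_implies_Suc by blast
    have "i \<notin> act (Suc p) \<omega>"
    proof (rule eliminated_in_time[OF big(1) p])
      fix k' assume "k' \<le> p"
      then have k': "k' < k" "k' < m" using p big less.prems by auto
      show "\<omega> \<notin> under k'" using assms(1)[OF k'(2)] by (auto simp: bad_def)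
      show "\<omega> \<notin> over k' i'" if "i' \<in> act k' \<omega> - best" for i'
        using less.IH[OF k' that] .
    qed
    moreover have "act k \<omega> \<subseteq> act (Suc p) \<omega>"
      using odaaf_run.active_decreasing[OF run] p big by simp
    ultimately show ?thesis using less.prems by auto
  qed
qed

lemma plays_le:
  assumes good: "\<And>k. k < m \<Longrightarrow> \<not> bad k \<omega>" and j: "j \<in> big" "last_phase (gap j) \<le> m"
  shows "card {t \<in> {1..T}. odaaf_arm K N (rew \<omega>) (del \<omega>) t = j} \<le> N (last_phase (gap j))"
proof -
  obtain p where p: "last_phase (gap j) = Suc p"
    using last_phase_pos gap_big[OF j(1)] gr0_implies_Suc by blast
  have "j \<notin> act (Suc p) \<omega>"
  proof (rule eliminated_in_time[OF j(1) p])
    fix k assume "k \<le> p"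
    then have k: "k < m" using p j by simp
    show "\<omega> \<notin> under k" using good[OF k] by (auto simp: bad_def)
    show "\<omega> \<notin> over k i" if "i \<in> act k \<omega> - best" for i by (rule not_over[OF good k that])
  qed
  moreover obtain m' where "T \<le> N m'" using odaaf_n_unbounded[OF Etau_nonneg T_pos] by blast
  then have "T \<le> rnd m' \<omega>" using odaaf_run.rounds_ge[OF run, of N m'] N_0 by (metis add.right_neutral le_trans)
  ultimately have "card {t \<in> {1..T}. odaaf_arm K N (rew \<omega>) (del \<omega>) t = j}
      \<le> card (odaaf_run.idx K N (rew \<omega>) (del \<omega>) (Suc p) j)"
    using odaaf_run.card_arm_le[OF run] by blast
  also have "\<dots> \<le> N (Suc p)"
    using last_phase_le_horizon[OF j(1)] p N_mono by (intro odaaf_run.card_idx_le[OF run] N_0) auto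
  finally show ?thesis by (simp add: p)
qed

lemma regret_eq:
  "regret \<omega> = (\<Sum>j\<in>subopt. gap j * real (card {t \<in> {1..T}. odaaf_arm K N (rew \<omega>) (del \<omega>) t = j}))"
proof -
  let ?a = "odaaf_arm K N (rew \<omega>) (del \<omega>)"
  obtain m' where "T \<le> N m'" using odaaf_n_unbounded[OF Etau_nonneg T_pos] by blast
  then have T: "T \<le> rnd m' \<omega>" using odaaf_run.rounds_ge[OF run, of N m'] N_0 by (metis add.right_neutral le_trans)
  have "regret \<omega> = (\<Sum>t\<in>{1..T}. \<Sum>j\<in>{1..K}. if ?a t = j then gap j else 0)"
    unfolding regret_def using odaaf_run.odaaf_arm_in[OF run T] by (intro sum.cong) (auto simp: sum.delta)
  also have "\<dots> = (\<Sum>j\<in>{1..K}. \<Sum>t\<in>{1..T}. if ?a t = j then gap j else 0)" by (rule sum.swap)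
  also have "\<dots> = (\<Sum>j\<in>{1..K}. gap j * real (card {t \<in> {1..T}. ?a t = j}))"
    by (intro sum.cong refl) (simp add: sum.inter_filter[symmetric] mult.commute)
  also have "\<dots> = (\<Sum>j\<in>subopt. gap j * real (card {t \<in> {1..T}. ?a t = j}))"
  proof (rule sum.mono_neutral_right)
    have "gap j = 0" if "j \<in> {1..K} - subopt" for j
      using gap[of j] that by (auto simp: subopt_def)
    then show "\<forall>j\<in>{1..K} - subopt. gap j * real (card {t \<in> {1..T}. ?a t = j}) = 0" by auto
  qed (auto simp: subopt_def)
  finally show ?thesis .
qed

lemma regret_le:
  "regret \<omega> \<le> (\<Sum>j\<in>subopt - big. 400 / gap j) + (\<Sum>j\<in>big. gap j * real (N (last_phase (gap j))))
    + (\<Sum>m<horizon. 19 / 5 * 2 powr (- real (Suc m)) * real T *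
        (indicator (under m) \<omega> + (\<Sum>i\<in>alive m. indicator (over m i) \<omega>)))"
    (is "_ \<le> ?small + ?big + (\<Sum>m<horizon. ?c m * ?ind m)")
proof -
  let ?P = "\<lambda>j. {t \<in> {1..T}. odaaf_arm K N (rew \<omega>) (del \<omega>) t = j}"
  let ?n = "\<lambda>j. real (card (?P j))"
  have ind: "0 \<le> ?ind m" for m by (intro add_nonneg_nonneg sum_nonneg) auto
  \<comment> \<open>The first bad phase, or \<open>horizon\<close> if there is none; in the latter
    case no arm is late.\<close>
  obtain m0 where m0: "m0 \<le> horizon" "m0 < horizon \<Longrightarrow> bad m0 \<omega>"
    and good: "\<And>k. k < m0 \<Longrightarrow> \<not> bad k \<omega>"
  proof (cases "\<exists>m<horizon. bad m \<omega>")
    case True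
    then obtain m where m: "m < horizon" "bad m \<omega>" "\<forall>k<m. \<not> (k < horizon \<and> bad k \<omega>)"
      using exists_least_iff[of "\<lambda>m. m < horizon \<and> bad m \<omega>"] by blast
    then have "\<not> bad k \<omega>" if "k < m" for k using that by simp
    then show ?thesis using m by (intro that[of m]) auto
  next
    case False
    then show ?thesis by (intro that[of horizon]) auto
  qed
  let ?late = "{j \<in> big. m0 < last_phase (gap j)}"
  have small: "(\<Sum>j\<in>subopt - big. gap j * ?n j) \<le> ?small"
  proof (rule sum_mono)
    fix j assume "j \<in> subopt - big"
    then have j: "0 < gap j" "real T * (gap j)\<^sup>2 \<le> 400"
      using gap_subopt[of j] by (auto simp: big_def)
    have "card (?P j) \<le> card {1..T}" by (intro card_mono) auto
    then have "gap j * ?n j \<le> gap j * real T" using j by (intro mult_left_mono) auto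
    also have "\<dots> \<le> 400 / gap j" using j by (simp add: pos_le_divide_eq power2_eq_square mult_ac)
    finally show "gap j * ?n j \<le> 400 / gap j" .
  qed
  have "(\<Sum>j\<in>big. gap j * ?n j) \<le> (\<Sum>j\<in>big. gap j * real (N (last_phase (gap j))) + (if m0 < last_phase (gap j) then gap j * ?n j else 0))"
  proof (rule sum_mono)
    fix j assume j: "j \<in> big"
    then have g: "0 < gap j" using gap_big by simp
    show "gap j * ?n j \<le> gap j * real (N (last_phase (gap j))) + (if m0 < last_phase (gap j) then gap j * ?n j else 0)"
    proof (cases "m0 < last_phase (gap j)")
      case True
      then show ?thesis using g by simp
    next
      case False
      then have "card (?P j) \<le> N (last_phase (gap j))" using plays_le[OF good j] by simp
      then show ?thesis using g False by simp
    qed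
  qed
  also have "\<dots> = ?big + (\<Sum>j\<in>?late. gap j * ?n j)"
    unfolding sum.distrib sum.inter_filter[OF finite_big] by (rule refl)
  finally have big: "(\<Sum>j\<in>big. gap j * ?n j) \<le> ?big + (\<Sum>j\<in>?late. gap j * ?n j)" .
  have late: "(\<Sum>j\<in>?late. gap j * ?n j) \<le> (\<Sum>m<horizon. ?c m * ?ind m)"
  proof (cases "?late = {}")
    case True
    then have "(\<Sum>j\<in>?late. gap j * ?n j) = 0" by (simp only: sum.empty)
    moreover have "0 \<le> (\<Sum>m<horizon. ?c m * ?ind m)" using ind by (intro sum_nonneg mult_nonneg_nonneg) auto
    ultimately show ?thesis by simp
  next
    case False
    then have lt: "m0 < horizon" using last_phase_le_horizon by fastforce
    have tol: "gap j \<le> 19 / 5 * 2 powr (- real (Suc m0))" if "j \<in> ?late" for j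
    proof -
      have "gap j \<le> 19 / 5 * 2 powr (- real (last_phase (gap j)))"
        using that gap_big by (intro last_phase_ge) auto
      moreover have "2 powr (- real (last_phase (gap j))) \<le> (2::real) powr (- real (Suc m0))"
        using that by (intro powr_mono) auto
      ultimately show ?thesis by linarith
    qed
    have "(\<Sum>j\<in>?late. gap j * ?n j) \<le> (\<Sum>j\<in>?late. 19 / 5 * 2 powr (- real (Suc m0)) * ?n j)"
      using tol by (intro sum_mono mult_right_mono) auto
    also have "\<dots> = 19 / 5 * 2 powr (- real (Suc m0)) * real (\<Sum>j\<in>?late. card (?P j))"
      by (simp only: sum_distrib_left[symmetric] of_nat_sum)
    \<comment> \<open>Late arms are played in disjoint sets of rounds, so together they take at most
      \<open>T\<close> rounds, whatever their number.\<close>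
    also have "(\<Sum>j\<in>?late. card (?P j)) = card (\<Union>j\<in>?late. ?P j)"
      using finite_big by (subst card_UN_disjoint) auto
    also have "19 / 5 * 2 powr (- real (Suc m0)) * real (card (\<Union>j\<in>?late. ?P j)) \<le> ?c m0"
    proof (rule mult_left_mono)
      have "card (\<Union>j\<in>?late. ?P j) \<le> card {1..T}" by (intro card_mono) auto
      then show "real (card (\<Union>j\<in>?late. ?P j)) \<le> real T" by simp
    qed simp
    also have "\<dots> = ?c m0 * 1" by simp
    also have "\<dots> \<le> ?c m0 * ?ind m0"
    proof (rule mult_left_mono)
      have fin: "finite (alive m0)" using finite_subopt by (simp add: alive_def)
      have "bad m0 \<omega>" using m0 lt by simp
      then show "1 \<le> ?ind m0"
        unfolding bad_def
      proof
        assume "\<omega> \<in> under m0"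
        then show ?thesis by (simp add: sum_nonneg)
      next
        assume "\<exists>i\<in>alive m0. \<omega> \<in> over m0 i"
        then obtain i where "i \<in> alive m0" "\<omega> \<in> over m0 i" by blast
        then have "1 \<le> (\<Sum>i\<in>alive m0. indicator (over m0 i) \<omega> :: real)"
          using member_le_sum[of i "alive m0" "\<lambda>i. indicator (over m0 i) \<omega> :: real"] fin by simp
        then show ?thesis by (simp add: add_increasing)
      qed
    qed simp
    also have "\<dots> \<le> (\<Sum>m<horizon. ?c m * ?ind m)"
      using ind lt by (intro member_le_sum mult_nonneg_nonneg) auto
    finally show ?thesis .
  qed
  have "regret \<omega> = (\<Sum>j\<in>subopt - big. gap j * ?n j) + (\<Sum>j\<in>big. gap j * ?n j)"
    unfolding regret_eq using sum.subset_diff[OF big_subset finite_subopt] by simp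
  then show ?thesis using small big late by linarith
qed

end

section \<open>Summing the failure costs over phases and arms\<close>

lemma sum_two_power: "(\<Sum>m<p. (2::real) ^ Suc m) \<le> 2 * 2 ^ p"
  by (induction p) auto

text \<open>An arm of \<open>big\<close> pays up to its own last phase. Any other suboptimal arm
  pays up to \<open>horizon\<close>, but \<open>horizon\<close> stems from an arm of at least its
  gap, so \<open>2^horizon\<close> is still at most \<open>19/5 / gap i\<close>. The constant is
  \<open>2 (19/5)^2 = 28.88\<close>, rounded up.\<close>

lemma sum_alive_le:
  assumes i: "i \<in> subopt"
  shows "(\<Sum>m<horizon. if i \<in> alive m then 19 / 5 * 2 ^ Suc m else 0) \<le> 29 / gap i"
proof -
  have g: "0 < gap i" "gap i \<le> 1" using gap_subopt[OF i] by auto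
  have bound: "(\<Sum>m<p. 19 / 5 * 2 ^ Suc m) \<le> 29 / gap i" if "2 ^ p \<le> 19 / 5 / gap i" for p :: nat
  proof -
    have "(\<Sum>m<p. 19 / 5 * 2 ^ Suc m) \<le> 19 / 5 * (2 * (19 / 5 / gap i))"
      unfolding sum_distrib_left[symmetric] using sum_two_power[of p] that by (intro mult_left_mono) linarith+
    also have "\<dots> \<le> 29 / gap i" using g by (simp add: field_simps)
    finally show ?thesis .
  qed
  show ?thesis
  proof (cases "i \<in> big")
    case True
    have "(\<Sum>m<horizon. if i \<in> alive m then 19 / 5 * 2 ^ Suc m else 0) = (\<Sum>m<last_phase (gap i). 19 / 5 * 2 ^ Suc m :: real)"
      using i True last_phase_le_horizon[OF True]
      by (intro sum.mono_neutral_cong_right) (auto simp: alive_def)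
    also have "\<dots> \<le> 29 / gap i" by (intro bound two_power_last_phase g)
    finally show ?thesis .
  next
    case False
    have "(\<Sum>m<horizon. if i \<in> alive m then 19 / 5 * 2 ^ Suc m else 0) = (\<Sum>m<horizon. 19 / 5 * 2 ^ Suc m :: real)"
      using i False by (intro sum.cong) (auto simp: alive_def)
    also have "\<dots> \<le> 29 / gap i"
    proof (cases "horizon = 0")
      case True
      then show ?thesis using g by simp
    next
      case False
      then obtain j where j: "j \<in> big" "last_phase (gap j) = horizon" using horizon_attained by auto
      have "real T * (gap i)\<^sup>2 < real T * (gap j)\<^sup>2"
        using gap_big[OF j(1)] i \<open>i \<notin> big\<close> by (simp add: big_def)
      then have "(gap i)\<^sup>2 < (gap j)\<^sup>2" using T_pos by simp
      then have "gap i \<le> gap j" using gap_big[OF j(1)] by (intro less_imp_le power_less_imp_less_base[of "gap i" 2]) auto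
      then have "19 / 5 / gap j \<le> 19 / 5 / gap i" using g by (intro divide_left_mono) auto
      then show ?thesis using two_power_last_phase[of "gap j"] gap_big[OF j(1)] j(2) by (intro bound) auto
    qed
    finally show ?thesis .
  qed
qed

text \<open>The event \<open>under m\<close> belongs to no suboptimal arm; its cost is charged to an
  arm that attains \<open>horizon\<close>, which is alive in all these phases.\<close>

lemma sum_horizon_le: "(\<Sum>m<horizon. 19 / 5 * 2 ^ Suc m) \<le> (\<Sum>j\<in>subopt. 29 / gap j)"
proof (cases "horizon = 0")
  case True
  moreover have "0 \<le> (\<Sum>j\<in>subopt. 29 / gap j)"
    using gap_subopt by (intro sum_nonneg) (simp add: less_imp_le)
  ultimately show ?thesis by simp
next
  case False
  then obtain j where j: "j \<in> big" "last_phase (gap j) = horizon" using horizon_attained by auto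
  then have s: "j \<in> subopt" using big_subset by auto
  have "(\<Sum>m<horizon. 19 / 5 * 2 ^ Suc m :: real) = (\<Sum>m<horizon. if j \<in> alive m then 19 / 5 * 2 ^ Suc m else 0)"
    using s j by (intro sum.cong) (auto simp: alive_def)
  also have "\<dots> \<le> 29 / gap j" by (rule sum_alive_le[OF s])
  also have "\<dots> \<le> (\<Sum>j\<in>subopt. 29 / gap j)"
    using s gap_subopt finite_subopt by (intro member_le_sum) (auto simp: less_imp_le)
  finally show ?thesis .
qed

lemma expected_regret_le:
  assumes T: "\<And>j. j \<in> subopt \<Longrightarrow> real T * (gap j)\<^sup>2 \<ge> 1"
  shows "expectation regret \<le> (\<Sum>j\<in>subopt. 128 * ln (real T * (gap j)\<^sup>2) / gap j
    + 32 / 3 * ln (real T * (gap j)\<^sup>2) + 96 * ln (4 / gap j) * Etau + 480 / gap j + gap j)"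
proof -
  let ?c = "\<lambda>m. 19 / 5 * 2 powr (- real (Suc m)) * real T :: real"
  let ?C = "(\<Sum>j\<in>subopt - big. 400 / gap j) + (\<Sum>j\<in>big. gap j * real (N (last_phase (gap j))))"
  let ?f = "\<lambda>\<omega>. ?C + (\<Sum>m<horizon. ?c m * (indicator (under m) \<omega> + (\<Sum>i\<in>alive m. indicator (over m i) \<omega>)))"
  let ?main = "\<lambda>j. 128 * ln (real T * (gap j)\<^sup>2) / gap j + 32 / 3 * ln (real T * (gap j)\<^sup>2) + 96 * ln (4 / gap j) * Etau + gap j"
  have [measurable]: "under m \<in> sets M" "over m i \<in> sets M" for m i by (rule under_sets over_sets)+
  have ind: "integrable M (indicator A :: 'a \<Rightarrow> real)" if "A \<in> sets M" for A
    using that by (intro integrable_real_indicator) (auto simp: emeasure_eq_measure)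
  have fin: "finite (alive m)" for m using finite_subopt by (simp add: alive_def)
  have intf: "integrable M ?f"
    by (intro Bochner_Integration.integrable_add integrable_const Bochner_Integration.integrable_sum
        integrable_mult_right ind under_sets over_sets)
  have nonneg: "0 \<le> ?f \<omega>" for \<omega>
    using gap_subopt gap_big
    by (intro add_nonneg_nonneg sum_nonneg mult_nonneg_nonneg divide_nonneg_nonneg) (auto simp: less_imp_le)
  \<comment> \<open>Integrability is established for the majorant; a non-integrable integrand has
    integral 0 by convention, a case covered by nonnegativity of the majorant.\<close>
  have "expectation regret \<le> expectation ?f"
  proof (rule integral_mono_AE')
    show "AE \<omega> in M. regret \<omega> \<le> ?f \<omega>"
      using AE_rewards AE_space by eventually_elim (rule regret_le, auto)
  qed (use intf nonneg in auto)
  also have "expectation ?f = ?C + (\<Sum>m<horizon. ?c m * (prob (under m) + (\<Sum>i\<in>alive m. prob (over m i))))"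
    using ind under_sets over_sets by (simp add: prob_space)
  also have "\<dots> \<le> ?C + (\<Sum>m<horizon. ?c m * (4 ^ Suc m / real T + (\<Sum>i\<in>alive m. 4 ^ Suc m / real T)))"
    by (intro add_left_mono sum_mono mult_left_mono add_mono prob_under prob_over) (auto simp: alive_def subopt_def)
  also have "(\<Sum>m<horizon. ?c m * (4 ^ Suc m / real T + (\<Sum>i\<in>alive m. 4 ^ Suc m / real T))) =
    (\<Sum>m<horizon. 19 / 5 * 2 ^ Suc m + (\<Sum>i\<in>subopt. if i \<in> alive m then 19 / 5 * 2 ^ Suc m else 0))"
  proof (rule sum.cong[OF refl])
    fix m
    have c: "?c m * (4 ^ Suc m / real T) = 19 / 5 * 2 ^ Suc m"
    proof -
      have "(4::real) ^ Suc m = 2 ^ Suc m * 2 ^ Suc m" by (simp only: power_mult_distrib[symmetric]) simp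
      then show ?thesis unfolding phase_tolerance using T_pos by simp
    qed
    have "alive m = {i \<in> subopt. i \<in> alive m}" by (auto simp: alive_def)
    then have "(\<Sum>i\<in>alive m. 19 / 5 * 2 ^ Suc m) = (\<Sum>i\<in>subopt. if i \<in> alive m then 19 / 5 * 2 ^ Suc m else 0 :: real)"
      using sum.inter_filter[OF finite_subopt, of "\<lambda>_. 19 / 5 * 2 ^ Suc m :: real" "\<lambda>i. i \<in> alive m"] by metis
    then show "?c m * (4 ^ Suc m / real T + (\<Sum>i\<in>alive m. 4 ^ Suc m / real T)) =
      19 / 5 * 2 ^ Suc m + (\<Sum>i\<in>subopt. if i \<in> alive m then 19 / 5 * 2 ^ Suc m else 0)"
      unfolding distrib_left sum_distrib_left c by (rule arg_cong)
  qed
  also have "?C + \<dots> \<le> ?C + ((\<Sum>j\<in>subopt. 29 / gap j) + (\<Sum>j\<in>subopt. 29 / gap j))"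
  proof (rule add_left_mono)
    have "(\<Sum>m<horizon. \<Sum>i\<in>subopt. if i \<in> alive m then 19 / 5 * 2 ^ Suc m else 0 :: real) =
      (\<Sum>i\<in>subopt. \<Sum>m<horizon. if i \<in> alive m then 19 / 5 * 2 ^ Suc m else 0)"
      by (rule sum.swap)
    also have "\<dots> \<le> (\<Sum>i\<in>subopt. 29 / gap i)" by (rule sum_mono) (rule sum_alive_le)
    finally show "(\<Sum>m<horizon. 19 / 5 * 2 ^ Suc m + (\<Sum>i\<in>subopt. if i \<in> alive m then 19 / 5 * 2 ^ Suc m else 0))
        \<le> (\<Sum>j\<in>subopt. 29 / gap j) + (\<Sum>j\<in>subopt. 29 / gap j)"
      unfolding sum.distrib using sum_horizon_le by (intro add_mono)
  qed
  also have "\<dots> \<le> (\<Sum>j\<in>subopt. ?main j + 480 / gap j)"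
  proof -
    \<comment> \<open>One sum of 29 pays for \<open>under\<close>, the other for
      \<open>over\<close>. Outside \<open>big\<close> the resulting 58 joins the 400, and 458 fits
      below 480.\<close>
    have "(\<Sum>j\<in>subopt. 29 / gap j) + (\<Sum>j\<in>subopt. 29 / gap j) = (\<Sum>j\<in>subopt - big. 58 / gap j) + (\<Sum>j\<in>big. 58 / gap j)"
      using sum.subset_diff[OF big_subset finite_subopt, of "\<lambda>j. 58 / gap j"]
      by (simp add: sum.distrib[symmetric] add_divide_distrib[symmetric])
    then have "?C + ((\<Sum>j\<in>subopt. 29 / gap j) + (\<Sum>j\<in>subopt. 29 / gap j)) =
      (\<Sum>j\<in>subopt - big. 400 / gap j + 58 / gap j) + (\<Sum>j\<in>big. gap j * real (N (last_phase (gap j))) + 58 / gap j)"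
      by (simp only: sum.distrib)
    also have "\<dots> \<le> (\<Sum>j\<in>subopt - big. ?main j + 480 / gap j) + (\<Sum>j\<in>big. ?main j + 480 / gap j)"
    proof (rule add_mono; rule sum_mono)
      fix j assume j: "j \<in> subopt - big"
      then have g: "0 < gap j" "gap j \<le> 1" using gap_subopt[of j] by auto
      \<comment> \<open>Here \<open>T gap^2 >= 1\<close> makes the logarithm nonnegative, so the
        main terms may be added for an arm bounded by \<open>400 / gap\<close> alone.\<close>
      have "0 \<le> ln (real T * (gap j)\<^sup>2)" "0 \<le> ln (4 / gap j)" using T[of j] j g by (auto simp: field_simps)
      then have "0 \<le> ?main j" using g Etau_nonneg by simp
      moreover have "400 / gap j + 58 / gap j \<le> 480 / gap j"
        using g by (simp add: add_divide_distrib[symmetric] divide_right_mono)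
      ultimately show "400 / gap j + 58 / gap j \<le> ?main j + 480 / gap j" by linarith
    next
      fix j assume j: "j \<in> big"
      then have "58 / gap j \<le> 480 / gap j" using gap_big by (intro divide_right_mono) (auto simp: less_imp_le)
      then show "gap j * real (N (last_phase (gap j))) + 58 / gap j \<le> ?main j + 480 / gap j"
        using odaaf_n_last_phase[of "gap j" T Etau] gap_big[OF j] Etau_nonneg by (intro add_mono) auto
    qed
    also have "\<dots> = (\<Sum>j\<in>subopt. ?main j + 480 / gap j)"
      by (rule sum.subset_diff[OF big_subset finite_subopt, symmetric])
    finally show ?thesis .
  qed
  also have "(\<Sum>j\<in>subopt. ?main j + 480 / gap j) = (\<Sum>j\<in>subopt. 128 * ln (real T * (gap j)\<^sup>2) / gap j
    + 32 / 3 * ln (real T * (gap j)\<^sup>2) + 96 * ln (4 / gap j) * Etau + 480 / gap j + gap j)"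
    by (intro sum.cong refl) linarith
  finally show ?thesis .
qed

end

section \<open>From the distributional hypotheses to the regret bound\<close>

theorem theorem1:
  fixes M :: "'a measure"
    and K T :: nat
    and \<zeta> :: "nat \<Rightarrow> real measure" and \<delta> :: "nat measure"
    and R :: "nat \<Rightarrow> nat \<Rightarrow> 'a \<Rightarrow> real" and D :: "nat \<Rightarrow> nat \<Rightarrow> 'a \<Rightarrow> nat"
    and \<mu> \<Delta> :: "nat \<Rightarrow> real" and \<mu>star Etau :: real
  assumes "prob_space M"
    and "K \<ge> 2"
    and arms: "\<And>j. j \<in> {1..K} \<Longrightarrow> prob_space (\<zeta> j) \<and> sets (\<zeta> j) = sets borel \<and> measure (\<zeta> j) {0..1} = 1"
    and delay: "prob_space \<delta>" "sets \<delta> = sets (count_space UNIV)"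
    and R_meas: "\<And>l j. R l j \<in> borel_measurable M"
    and D_meas: "\<And>l j. D l j \<in> measurable M (count_space UNIV)"
    and R_distr: "\<And>l j. l \<ge> 1 \<Longrightarrow> j \<in> {1..K} \<Longrightarrow> distr M borel (R l j) = \<zeta> j"
    and D_distr: "\<And>l j. l \<ge> 1 \<Longrightarrow> j \<in> {1..K} \<Longrightarrow> distr M (count_space UNIV) (D l j) = \<delta>"
    and indep: "prob_space.indep_vars M (\<lambda>_. borel)
        (\<lambda>(b, l, j). if b then R l j else (\<lambda>\<omega>. real (D l j \<omega>)))
        (UNIV \<times> {1..} \<times> {1..K})"
    and mu_def: "\<And>j. \<mu> j = (\<integral>x. x \<partial>\<zeta> j)"
    and mustar_def: "\<mu>star = Max (\<mu> ` {1..K})"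
    and Delta_def: "\<And>j. \<Delta> j = \<mu>star - \<mu> j"
    and assm1: "integrable \<delta> (\<lambda>n. real n)"
    and Etau_def: "Etau = (\<integral>n. real n \<partial>\<delta>)"
    and horizon: "\<And>j. j \<in> {1..K} \<Longrightarrow> \<Delta> j > 0 \<Longrightarrow> real T * (\<Delta> j)\<^sup>2 \<ge> 1"
  shows "prob_space.expectation M
           (\<lambda>\<omega>. \<Sum>t\<in>{1..T}. \<mu>star - \<mu> (odaaf_arm K (odaaf_n T Etau)
                                      (\<lambda>l j. R l j \<omega>) (\<lambda>l j. D l j \<omega>) t))
         \<le> (\<Sum>j\<in>{j\<in>{1..K}. \<Delta> j > 0}.
              128 * ln (real T * (\<Delta> j)\<^sup>2) / \<Delta> j + 32 / 3 * ln (real T * (\<Delta> j)\<^sup>2)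
              + 96 * ln (4 / \<Delta> j) * Etau + 480 / \<Delta> j + \<Delta> j)"
proof (cases "T = 0")
  case True
  \<comment> \<open>With no rounds, the hypothesis on \<open>T\<close> and the gaps leaves no
    suboptimal arm, and both sides are 0.\<close>
  then have empty: "{j \<in> {1..K}. \<Delta> j > 0} = {}" using horizon by fastforce
  show ?thesis unfolding empty using True by simp
next
  case False
  interpret prob_space M by fact
  interpret \<delta>: prob_space \<delta> by fact
  have set_\<delta>: "A \<in> sets \<delta>" for A using delay(2) by simp
  have space_\<delta>: "space \<delta> = UNIV" using sets_eq_imp_space_eq[OF delay(2)] by simp
  let ?tail = "\<lambda>c. measure \<delta> {c..}"
  let ?best = "{j \<in> {1..K}. \<mu> j = \<mu>star}"
  have AE_R: "AE \<omega> in M. R l j \<omega> \<in> {0..1}" if "l \<ge> 1" "j \<in> {1..K}" for l j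
  proof -
    interpret \<zeta>: prob_space "\<zeta> j" using arms that by simp
    have "AE x in \<zeta> j. x \<in> {0..1}"
      using arms[OF that(2)] by (intro \<zeta>.AE_prob_1) simp
    then have "AE x in distr M borel (R l j). x \<in> {0..1}" unfolding R_distr[OF that] .
    then show ?thesis by (rule AE_distrD[OF R_meas])
  qed
  have mean_R: "expectation (R l j) = \<mu> j" if "l \<ge> 1" "j \<in> {1..K}" for l j
    unfolding mu_def R_distr[OF that, symmetric] by (subst integral_distr) (auto intro: R_meas)
  have tail: "prob {\<omega> \<in> space M. c \<le> D l j \<omega>} = ?tail c" if "l \<ge> 1" "j \<in> {1..K}" for l j c
    unfolding D_distr[OF that, symmetric]
    by (subst measure_distr[OF D_meas]) (auto intro!: arg_cong[where f = prob])
  \<comment> \<open>A delay \<open>x\<close> reaches at most \<open>x\<close> positive thresholds;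
    integrating this count gives the bound.\<close>
  have tail_sum: "(\<Sum>c\<in>C. ?tail c) \<le> Etau" if C: "finite C" "0 \<notin> C" for C :: "nat set"
  proof -
    have ind: "integrable \<delta> (indicator {c..} :: nat \<Rightarrow> real)" for c
      using set_\<delta> by (intro integrable_real_indicator) (auto simp: \<delta>.emeasure_eq_measure)
    have "(\<Sum>c\<in>C. ?tail c) = (\<integral>x. (\<Sum>c\<in>C. indicator {c..} x) \<partial>\<delta>)"
      using ind set_\<delta> by (subst Bochner_Integration.integral_sum) (auto simp: space_\<delta>)
    also have "\<dots> \<le> (\<integral>x. real x \<partial>\<delta>)"
    proof (rule integral_mono)
      fix x :: nat
      have "(\<Sum>c\<in>C. indicator {c..} x :: real) = real (card {c \<in> C. c \<le> x})"
        using C by (simp add: indicator_def sum.If_cases Int_def)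
      also have "card {c \<in> C. c \<le> x} \<le> card {1..x}"
        using C by (intro card_mono) (auto simp: Suc_le_eq intro: gr0I)
      finally show "(\<Sum>c\<in>C. indicator {c..} x) \<le> real x" by simp
    qed (use ind assm1 in auto)
    finally show ?thesis by (simp add: Etau_def)
  qed
  have mu_range: "0 \<le> \<mu> j \<and> \<mu> j \<le> 1" if "j \<in> {1..K}" for j
  proof -
    \<comment> \<open>Round 1 stands for any round; means in \<open>{0..1}\<close> are what keeps
      the gaps at most 1.\<close>
    have int: "integrable M (R 1 j)"
      using AE_R[of 1 j] that by (intro integrable_const_bound[where B = 1] R_meas) auto
    have "0 \<le> expectation (R 1 j)" using AE_R[of 1 j] that by (intro integral_nonneg_AE) auto
    moreover have "expectation (R 1 j) \<le> expectation (\<lambda>_. 1)"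
      using AE_R[of 1 j] that int by (intro integral_mono_AE) auto
    ultimately show ?thesis using mean_R[of 1 j] that by (simp add: prob_space)
  qed
  have star: "\<mu>star \<in> \<mu> ` {1..K}" "\<And>j. j \<in> {1..K} \<Longrightarrow> \<mu> j \<le> \<mu>star"
    unfolding mustar_def using \<open>K \<ge> 2\<close> by (auto intro!: Max_in Max_ge)
  interpret odaaf_regret M K R D T \<mu> ?tail Etau ?best \<mu>star
  proof unfold_locales
    show "R l j \<in> borel_measurable M" "D l j \<in> measurable M (count_space UNIV)" for l j
      by (rule R_meas D_meas)+
    show "indep_vars (\<lambda>_. borel) (\<lambda>(b, l, j). if b then R l j else (\<lambda>\<omega>. real (D l j \<omega>)))
        (UNIV \<times> {1..} \<times> {1..K})" by (rule indep)
    show "1 \<le> K" using \<open>K \<ge> 2\<close> by simp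
    show "0 < T" using False by simp
    show "0 \<le> Etau" unfolding Etau_def by (rule Bochner_Integration.integral_nonneg) simp
    show "?best \<noteq> {}" using star(1) by auto
    show "0 \<le> \<mu>star - \<mu> j \<and> \<mu>star - \<mu> j \<le> 1" if "j \<in> {1..K}" for j
    proof -
      obtain b where "b \<in> {1..K}" "\<mu>star = \<mu> b" using star(1) by auto
      then show ?thesis using star(2)[OF that] mu_range[OF that] mu_range[of b] by simp
    qed
  qed (rule AE_R mean_R tail tail_sum refl; assumption)+
  have \<Delta>: "\<Delta> = gap" by (simp add: fun_eq_iff Delta_def gap_def)
  have sub: "{j \<in> {1..K}. gap j > 0} = subopt" by (simp add: subopt_def)
  have "expectation (\<lambda>\<omega>. \<Sum>t\<in>{1..T}. \<mu>star - \<mu> (odaaf_arm K N (rew \<omega>) (del \<omega>) t)) = expectation regret"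
    unfolding regret_def[abs_def] gap_def by (rule refl)
  also have "\<dots> \<le> (\<Sum>j\<in>subopt. 128 * ln (real T * (gap j)\<^sup>2) / gap j
    + 32 / 3 * ln (real T * (gap j)\<^sup>2) + 96 * ln (4 / gap j) * Etau + 480 / gap j + gap j)"
    using horizon by (intro expected_regret_le) (simp add: subopt_def \<Delta>)
  finally show ?thesis unfolding \<Delta> sub .
qed

end
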